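(* Let $\Phi$ be a root system of rank $r$ with Weyl group $W$, weight lattice $\Lambda$, root lattice $L$ and simple roots $\alpha_1,\dots,\alpha_r$. For a dominant weight $\lambda\in\Lambda$, the sum of formal exponents over the lattice points of the weight polytope, $$S(P_W(\lambda)):=\sum_{\mu\in P_W(\lambda)\cap(L+\lambda)}e^{\mu},$$ satisfies the following identity in the field of rational expressions in the formal exponents: $$S(P_W(\lambda))=\sum_{w\in W}\frac{e^{w(\lambda)}}{(1-e^{-w(\alpha_1)})\cdots(1-e^{-w(\alpha_r)})}.$$
   Context: $\Phi$ is a (reduced, crystallographic) root system of rank $r$, $\Lambda$ its integer weight lattice, $\Lambda_{\mathbb{R}}=\Lambda\otimes\mathbb{R}$, $L\subseteq\Lambda$ the lattice spanned by the roots, and $W$ the Weyl group acting on $\Lambda_{\mathbb{R}}$, with a nondegenerate $W$-invariant inner product $(\cdot,\cdot)$. Simple roots $\alpha_1,\dots,\alpha_r$ are fixed. A weight $\lambda$ is dominant if $(\lambda,\alpha_i)\ge0$ for all $i$. The weight polytope is $P_W(\lambda)=\mathrm{ConvexHull}(w(\lambda)\mid w\in W)\subset\Lambda_{\mathbb{R}}$. The formal exponents $e^\mu$, $\mu\in\Lambda$, satisfy $e^\mu\cdot e^\nu=e^{\mu+\nu}$, i.e. they form the basis of the group algebra of $\Lambda$; the field of rational expressions in formal exponents is the field of fractions of this group algebra. *)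

theory Defs
  imports
    "HOL-Analysis.Analysis"
    "HOL-Library.Poly_Mapping"
    "HOL-Computational_Algebra.Polynomial_Factorial"
begin

section \<open>Root systems\<close>

text \<open>
  A root system lives in an ambient Euclidean space and need not span it: the space
  \<open>\<Lambda>\<^sub>\<real>\<close> is \<^term>\<open>span \<Phi>\<close>. The inner product of the ambient space plays the role of the
  Weyl-invariant one; it is invariant because the Weyl group is generated by orthogonal reflections.
\<close>

definition refl_along :: "'a::real_inner \<Rightarrow> 'a \<Rightarrow> 'a" where
  "refl_along \<alpha> v = v - (2 * (v \<bullet> \<alpha>) / (\<alpha> \<bullet> \<alpha>)) *\<^sub>R \<alpha>"

definition root_system :: "'a::euclidean_space set \<Rightarrow> bool" where
  "root_system \<Phi> \<longleftrightarrow>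
     finite \<Phi> \<and> 0 \<notin> \<Phi> \<and>
     (\<forall>\<alpha>\<in>\<Phi>. refl_along \<alpha> ` \<Phi> = \<Phi>) \<and>
     (\<forall>\<alpha>\<in>\<Phi>. \<forall>\<beta>\<in>\<Phi>. 2 * (\<beta> \<bullet> \<alpha>) / (\<alpha> \<bullet> \<alpha>) \<in> \<int>) \<and>
     (\<forall>\<alpha>\<in>\<Phi>. \<forall>c::real. c *\<^sub>R \<alpha> \<in> \<Phi> \<longrightarrow> c = 1 \<or> c = -1)"

text \<open>Reflections are involutions, so the monoid they generate is already a group.\<close>

inductive_set weyl_group :: "'a::real_inner set \<Rightarrow> ('a \<Rightarrow> 'a) set" for \<Phi> where
  id: "id \<in> weyl_group \<Phi>"
| refl: "\<alpha> \<in> \<Phi> \<Longrightarrow> w \<in> weyl_group \<Phi> \<Longrightarrow> refl_along \<alpha> \<circ> w \<in> weyl_group \<Phi>"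

definition weight_lattice :: "'a::real_inner set \<Rightarrow> 'a set" where
  "weight_lattice \<Phi> = {v \<in> span \<Phi>. \<forall>\<alpha>\<in>\<Phi>. 2 * (v \<bullet> \<alpha>) / (\<alpha> \<bullet> \<alpha>) \<in> \<int>}"

definition root_lattice :: "'a::real_inner set \<Rightarrow> 'a set" where
  "root_lattice \<Phi> = {\<Sum>\<alpha>\<in>\<Phi>. of_int (c \<alpha>) *\<^sub>R \<alpha> | c :: 'a \<Rightarrow> int. True}"

definition simple_roots :: "'a::real_inner set \<Rightarrow> nat \<Rightarrow> (nat \<Rightarrow> 'a) \<Rightarrow> bool" where
  "simple_roots \<Phi> r \<alpha> \<longleftrightarrow>
     inj_on \<alpha> {1..r} \<and> \<alpha> ` {1..r} \<subseteq> \<Phi> \<and> independent (\<alpha> ` {1..r}) \<and>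
     (\<forall>\<beta>\<in>\<Phi>. \<exists>c :: nat \<Rightarrow> nat.
        \<beta> = (\<Sum>i=1..r. of_nat (c i) *\<^sub>R \<alpha> i) \<or> \<beta> = - (\<Sum>i=1..r. of_nat (c i) *\<^sub>R \<alpha> i))"

definition dominant :: "nat \<Rightarrow> (nat \<Rightarrow> 'a::real_inner) \<Rightarrow> 'a \<Rightarrow> bool" where
  "dominant r \<alpha> v \<longleftrightarrow> (\<forall>i\<in>{1..r}. v \<bullet> \<alpha> i \<ge> 0)"

definition weight_polytope :: "'a::real_inner set \<Rightarrow> 'a \<Rightarrow> 'a set" where
  "weight_polytope \<Phi> v = convex hull {w v | w. w \<in> weyl_group \<Phi>}"

section \<open>Formal exponents\<close>

text \<open>
  \<open>('a, 'k) group_algebra\<close> is the group algebra over \<open>'k\<close> of the additive group of \<open>'a\<close>: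
  finitely supported functions with convolution. It contains the group algebra of the weight
  lattice as the subring of elements supported on the lattice, so its field of fractions contains
  the field of rational expressions in the exponents of weights as a subfield.

  It is a copy of the type of finitely supported functions because the library makes the latter
  an integral domain only for linearly ordered exponents, which vectors do not have.
\<close>

typedef (overloaded) ('a, 'k::zero) group_algebra = "UNIV :: ('a \<Rightarrow>\<^sub>0 'k) set" ..

setup_lifting type_definition_group_algebra

instantiation group_algebra :: (comm_monoid_add, comm_ring_1) comm_ring_1
begin

lift_definition zero_group_algebra :: "('a, 'b) group_algebra" is 0 .
lift_definition one_group_algebra :: "('a, 'b) group_algebra" is 1 .
lift_definition plus_group_algebra ::
  "('a, 'b) group_algebra \<Rightarrow> ('a, 'b) group_algebra \<Rightarrow> ('a, 'b) group_algebra" is "(+)" .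
lift_definition minus_group_algebra ::
  "('a, 'b) group_algebra \<Rightarrow> ('a, 'b) group_algebra \<Rightarrow> ('a, 'b) group_algebra" is "(-)" .
lift_definition uminus_group_algebra ::
  "('a, 'b) group_algebra \<Rightarrow> ('a, 'b) group_algebra" is uminus .
lift_definition times_group_algebra ::
  "('a, 'b) group_algebra \<Rightarrow> ('a, 'b) group_algebra \<Rightarrow> ('a, 'b) group_algebra" is "(*)" .

instance
  by intro_classes (transfer; simp add: algebra_simps)+

end

lemma exists_nonorthogonal:
  fixes S :: "'a::real_inner set"
  assumes "finite S" "0 \<notin> S"
  shows "\<exists>v. \<forall>s\<in>S. v \<bullet> s \<noteq> 0"
  using assms
proof (induction S rule: finite_induct)
  case empty
  then show ?case by simp
next
  case (insert s S)
  then obtain v where v: "\<forall>t\<in>S. v \<bullet> t \<noteq> 0" by auto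
  define B where "B = (\<lambda>t. - (v \<bullet> t) / (s \<bullet> t)) ` insert s S"
  have "finite B" using insert by (simp add: B_def)
  then obtain c where c: "c \<notin> B" using ex_new_if_finite infinite_UNIV_char_0 by blast
  have "(v + c *\<^sub>R s) \<bullet> t \<noteq> 0" if t: "t \<in> insert s S" for t
  proof
    assume "(v + c *\<^sub>R s) \<bullet> t = 0"
    then have eq: "v \<bullet> t + c * (s \<bullet> t) = 0" by (simp add: inner_add_left)
    show False
    proof (cases "s \<bullet> t = 0")
      case True
      with eq v t insert.prems show False by auto
    next
      case False
      with eq have "c = - (v \<bullet> t) / (s \<bullet> t)" by (simp add: field_simps)
      with c t show False by (auto simp: B_def)
    qed
  qed
  then show ?case by blast
qed

lemma poly_mapping_no_zero_divisors:
  fixes f g :: "'a::real_inner \<Rightarrow>\<^sub>0 'k::idom"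
  assumes "f \<noteq> 0" "g \<noteq> 0"
  shows "f * g \<noteq> 0"
proof -
  let ?K = "Poly_Mapping.keys f \<union> Poly_Mapping.keys g"
  define S where "S = (\<lambda>(x, y). x - y) ` (?K \<times> ?K) - {0}"
  have "finite S" "0 \<notin> S" by (auto simp: S_def)
  then obtain v where v: "\<forall>s\<in>S. v \<bullet> s \<noteq> 0" using exists_nonorthogonal by blast
  have inj: "x = y" if "x \<in> ?K" "y \<in> ?K" "v \<bullet> x = v \<bullet> y" for x y
  proof (rule ccontr)
    assume "x \<noteq> y"
    with that have "x - y \<in> S" by (force simp: S_def)
    with v that show False by (auto simp: inner_diff_right)
  qed
  have mx: "\<exists>x\<in>Poly_Mapping.keys h. \<forall>y\<in>Poly_Mapping.keys h. v \<bullet> y \<le> v \<bullet> x" if "h \<noteq> 0" for h :: "'a \<Rightarrow>\<^sub>0 'k"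
  proof -
    have ne: "Poly_Mapping.keys h \<noteq> {}" using that by simp
    let ?m = "Max ((\<bullet>) v ` Poly_Mapping.keys h)"
    have "?m \<in> (\<bullet>) v ` Poly_Mapping.keys h" using ne by (intro Max_in) auto
    then obtain x where "x \<in> Poly_Mapping.keys h" "?m = v \<bullet> x" by auto
    moreover have "\<forall>y\<in>Poly_Mapping.keys h. v \<bullet> y \<le> ?m" by simp
    ultimately show ?thesis by auto
  qed
  obtain x where x: "x \<in> Poly_Mapping.keys f" "\<And>y. y \<in> Poly_Mapping.keys f \<Longrightarrow> v \<bullet> y \<le> v \<bullet> x"
    using mx[OF assms(1)] by blast
  obtain y where y: "y \<in> Poly_Mapping.keys g" "\<And>z. z \<in> Poly_Mapping.keys g \<Longrightarrow> v \<bullet> z \<le> v \<bullet> y"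
    using mx[OF assms(2)] by blast
  have uniq: "l = x \<and> q = y" if "l \<in> Poly_Mapping.keys f" "q \<in> Poly_Mapping.keys g" "x + y = l + q" for l q
  proof -
    have "v \<bullet> x + v \<bullet> y = v \<bullet> l + v \<bullet> q" using that by (metis inner_add_right)
    with x(2)[OF that(1)] y(2)[OF that(2)] have "v \<bullet> l = v \<bullet> x" "v \<bullet> q = v \<bullet> y" by auto
    with inj x(1) y(1) that show ?thesis by blast
  qed
  have "Poly_Mapping.lookup (f * g) (x + y) = (\<Sum>l. Poly_Mapping.lookup f l * (\<Sum>q. Poly_Mapping.lookup g q when x + y = l + q))"
    by (simp add: lookup_mult)
  also have "\<dots> = (\<Sum>l. Poly_Mapping.lookup f x * Poly_Mapping.lookup g y when l = x)"
  proof (rule arg_cong[where f = Sum_any], rule ext)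
    fix l
    show "Poly_Mapping.lookup f l * (\<Sum>q. Poly_Mapping.lookup g q when x + y = l + q) = (Poly_Mapping.lookup f x * Poly_Mapping.lookup g y when l = x)"
    proof (cases "l = x")
      case True
      then show ?thesis by simp
    next
      case False
      have "Poly_Mapping.lookup f l * (Poly_Mapping.lookup g q when x + y = l + q) = 0" for q
        using uniq[of l q] False by (auto simp: in_keys_iff when_def)
      then have "Poly_Mapping.lookup f l = 0 \<or> (\<forall>q. (Poly_Mapping.lookup g q when x + y = l + q) = 0)"
        by auto
      then show ?thesis using False by auto
    qed
  qed
  also have "\<dots> = Poly_Mapping.lookup f x * Poly_Mapping.lookup g y" by simp
  also have "\<dots> \<noteq> 0" using x(1) y(1) by (simp add: in_keys_iff)
  finally show ?thesis by auto
qed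

instance group_algebra :: (real_inner, idom) idom
  by intro_classes (transfer; rule poly_mapping_no_zero_divisors)

lift_definition exponent :: "'a \<Rightarrow> ('a, 'k::comm_ring_1) group_algebra" is
  "\<lambda>\<mu>. Poly_Mapping.single \<mu> 1" .

definition fexp :: "'a::real_inner \<Rightarrow> ('a, 'k::idom) group_algebra fract" where
  "fexp \<mu> = to_fract (exponent \<mu>)"

lemma fexp_add: "fexp (\<mu> + \<nu>) = fexp \<mu> * fexp \<nu>"
proof -
  have "exponent (\<mu> + \<nu>) = exponent \<mu> * (exponent \<nu> :: ('a, 'b) group_algebra)"
    by transfer (simp add: mult_single)
  then show ?thesis by (simp add: fexp_def)
qed

text \<open>
  The index set is the intersection of a compact set with a translate of a lattice, hence finite,
  so the convention that a sum over an infinite set is 0 does not intervene.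
\<close>

definition lattice_point_sum ::
    "'a::euclidean_space set \<Rightarrow> 'a \<Rightarrow> ('a, 'k::idom) group_algebra fract" where
  "lattice_point_sum \<Phi> v =
     (\<Sum>\<mu> \<in> weight_polytope \<Phi> v \<inter> (\<lambda>\<beta>. \<beta> + v) ` root_lattice \<Phi>. fexp \<mu>)"

end

(*
  Expand every summand of the right-hand side as a signed indicator function of a cone, choosing for
  each factor 1 / (1 - e^(-w alpha_i)) the direction of expansion by the sign of the root w alpha_i.
  The sum E of these functions is invariant under the Weyl group: the terms that change under a
  simple reflection s_j cancel in pairs w, s_j w. At a dominant point all terms except that of w = 1
  vanish by Langlands' combinatorial lemma, and the remaining one is the indicator function of the
  cone below lam, which on dominant points agrees with that of the polytope. So E is the indicator
  function of the polytope. Since the group algebra acts on all functions by convolution, and the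
  denominator of each summand sends its signed indicator function to a point mass, multiplying
  by a common denominator turns this into the identity of rational expressions, without a
  completion of the group algebra.
*)

theory Submission
  imports Defs
begin

declare One_nat_def [simp del]

section \<open>Reflections and the Weyl group\<close>

lemma refl_along_self: "\<alpha> \<noteq> 0 \<Longrightarrow> refl_along \<alpha> \<alpha> = - \<alpha>"
  by (simp add: refl_along_def scaleR_2)

lemma refl_along_minus: "refl_along (- \<alpha>) = refl_along \<alpha>"
  by (simp add: refl_along_def fun_eq_iff)

lemma refl_along_refl_along [simp]: "refl_along \<alpha> (refl_along \<alpha> v) = v"
  by (cases "\<alpha> = 0") (simp_all add: refl_along_def inner_diff_left algebra_simps)

lemma orthogonal_transformation_refl_along: "orthogonal_transformation (refl_along \<alpha>)"
proof -
  have "linear (refl_along \<alpha>)"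
    by (intro linearI) (simp_all add: refl_along_def inner_add_left algebra_simps add_divide_distrib)
  moreover have "refl_along \<alpha> v \<bullet> refl_along \<alpha> w = v \<bullet> w" for v w
    by (cases "\<alpha> = 0")
      (simp_all add: refl_along_def inner_diff_left inner_diff_right inner_commute field_simps)
  ultimately show ?thesis
    by (simp add: orthogonal_transformation_def)
qed

lemma orthogonal_transformation_refl_along_conj:
  assumes "orthogonal_transformation w"
  shows "w (refl_along \<alpha> v) = refl_along (w \<alpha>) (w v)"
  using assms
  by (simp add: refl_along_def orthogonal_transformation_def linear_diff linear_scale)

lemma weyl_group_orthogonal:
  "w \<in> weyl_group \<Phi> \<Longrightarrow> orthogonal_transformation w"
  by (induction rule: weyl_group.induct)
    (auto simp: id_def orthogonal_transformation_refl_along orthogonal_transformation_compose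
      simp del: o_apply)

lemma weyl_group_linear: "w \<in> weyl_group \<Phi> \<Longrightarrow> linear w"
  using weyl_group_orthogonal orthogonal_transformation_linear by blast

lemma weyl_group_inner: "w \<in> weyl_group \<Phi> \<Longrightarrow> w x \<bullet> w y = x \<bullet> y"
  using weyl_group_orthogonal by (auto simp: orthogonal_transformation_def)

lemma weyl_group_bij:
  fixes \<Phi> :: "'a::euclidean_space set"
  shows "w \<in> weyl_group \<Phi> \<Longrightarrow> bij w"
  using weyl_group_orthogonal orthogonal_transformation_bij by blast

lemma weyl_group_inv_apply [simp]:
  fixes \<Phi> :: "'a::euclidean_space set"
  assumes "w \<in> weyl_group \<Phi>"
  shows "w (inv w x) = x" "inv w (w x) = x"
  using weyl_group_bij[OF assms] by (auto simp: bij_def surj_f_inv_f)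

lemma weyl_group_comp:
  "v \<in> weyl_group \<Phi> \<Longrightarrow> w \<in> weyl_group \<Phi> \<Longrightarrow> v \<circ> w \<in> weyl_group \<Phi>"
  by (induction rule: weyl_group.induct) (auto simp: comp_assoc intro: weyl_group.refl)

lemma weyl_group_refl_along: "\<beta> \<in> \<Phi> \<Longrightarrow> refl_along \<beta> \<in> weyl_group \<Phi>"
  using weyl_group.refl[OF _ weyl_group.id] by fastforce

lemma weyl_group_inv:
  fixes \<Phi> :: "'a::euclidean_space set"
  assumes "w \<in> weyl_group \<Phi>"
  shows "inv w \<in> weyl_group \<Phi>"
  using assms
proof (induction rule: weyl_group.induct)
  case id
  show ?case by (metis inv_id weyl_group.id)
next
  case (refl \<beta> w)
  have "inv (refl_along \<beta> \<circ> w) = inv w \<circ> refl_along \<beta>"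
    using refl by (intro inv_unique_comp) (auto simp: fun_eq_iff)
  moreover have "inv w \<circ> refl_along \<beta> \<in> weyl_group \<Phi>"
    using refl by (intro weyl_group_comp weyl_group_refl_along)
  ultimately show ?case
    by (simp only:)
qed

lemma weyl_group_inner_inv:
  fixes \<Phi> :: "'a::euclidean_space set"
  assumes "w \<in> weyl_group \<Phi>"
  shows "inv w x \<bullet> y = x \<bullet> w y"
  using weyl_group_inner[OF assms, of "inv w x" y] assms by simp

lemma weyl_group_diff_span: "w \<in> weyl_group \<Phi> \<Longrightarrow> w x - x \<in> span \<Phi>"
proof (induction rule: weyl_group.induct)
  case id
  then show ?case by (simp add: span_zero)
next
  case (refl \<beta> w)
  have "(refl_along \<beta> \<circ> w) x - x = (w x - x) - (2 * (w x \<bullet> \<beta>) / (\<beta> \<bullet> \<beta>)) *\<^sub>R \<beta>"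
    by (simp add: refl_along_def)
  with refl show ?case
    by (metis span_base span_diff span_scale)
qed

lemma weyl_group_root:
  assumes "root_system \<Phi>" "w \<in> weyl_group \<Phi>" "\<beta> \<in> \<Phi>"
  shows "w \<beta> \<in> \<Phi>"
  using assms(2,3,1) by induction (auto simp: root_system_def)

lemma root_minus:
  assumes "root_system \<Phi>" "\<beta> \<in> \<Phi>"
  shows "- \<beta> \<in> \<Phi>"
proof -
  have "\<beta> \<noteq> 0" using assms by (auto simp: root_system_def)
  then show ?thesis
    using weyl_group_root[OF assms(1) weyl_group_refl_along[OF assms(2)] assms(2)]
    by (simp add: refl_along_self)
qed

text \<open>Weyl group elements map the finite set of roots to itself and fix the orthogonal
  complement of its span pointwise, so each is determined by its restriction to
  \<open>\<Phi>\<close>.\<close>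

lemma finite_weyl_group:
  fixes \<Phi> :: "'a::euclidean_space set"
  assumes "root_system \<Phi>"
  shows "finite (weyl_group \<Phi>)"
proof (rule inj_on_finite)
  show "inj_on (\<lambda>w. restrict w \<Phi>) (weyl_group \<Phi>)"
  proof (rule inj_onI)
    fix v w assume vw: "v \<in> weyl_group \<Phi>" "w \<in> weyl_group \<Phi>" "restrict v \<Phi> = restrict w \<Phi>"
    have eq: "v \<beta> = w \<beta>" if "\<beta> \<in> \<Phi>" for \<beta>
      using vw(3) that by (metis restrict_apply')
    show "v = w"
    proof
      fix x
      obtain y z where yz: "y \<in> span \<Phi>" "\<And>u. u \<in> span \<Phi> \<Longrightarrow> orthogonal z u" "x = y + z"
        using orthogonal_subspace_decomp_exists by blast
      have fix_z: "u z = z" if "u \<in> weyl_group \<Phi>" for u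
        using that
      proof (induction rule: weyl_group.induct)
        case (refl \<beta> u)
        then show ?case
          using yz(2)[of \<beta>] by (simp add: refl_along_def orthogonal_def span_base)
      qed simp
      have "v y = w y"
        by (rule linear_eq_on_span[OF weyl_group_linear[OF vw(1)] weyl_group_linear[OF vw(2)] eq yz(1)])
      then show "v x = w x"
        using vw(1,2) by (simp add: yz(3) linear_add[OF weyl_group_linear] fix_z)
    qed
  qed
  show "(\<lambda>w. restrict w \<Phi>) ` weyl_group \<Phi> \<subseteq> \<Phi> \<rightarrow>\<^sub>E \<Phi>"
    using weyl_group_root[OF assms] by (auto simp: PiE_iff)
  show "finite (\<Phi> \<rightarrow>\<^sub>E \<Phi>)"
    using assms by (auto simp: root_system_def intro: finite_PiE)
qed

section \<open>Coordinates with respect to simple roots\<close>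

locale simple_system =
  fixes \<Phi> :: "'a::euclidean_space set" and r :: nat and \<alpha> :: "nat \<Rightarrow> 'a"
  assumes root_system: "root_system \<Phi>"
    and simple_roots: "simple_roots \<Phi> r \<alpha>"
begin

text \<open>The dual basis of the simple roots. The roots need not span the ambient space, so each
  functional is some linear extension to all of it, with arbitrary values off
  \<open>span \<Phi>\<close>.\<close>

definition coord :: "nat \<Rightarrow> 'a \<Rightarrow> real" where
  "coord i = (SOME f. linear f \<and> (\<forall>j\<in>{1..r}. f (\<alpha> j) = (if j = i then 1 else 0)))"

lemma simple_root: "i \<in> {1..r} \<Longrightarrow> \<alpha> i \<in> \<Phi>"
  using simple_roots by (auto simp: simple_roots_def)

lemma root_nonzero: "\<beta> \<in> \<Phi> \<Longrightarrow> \<beta> \<noteq> 0"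
  using root_system by (auto simp: root_system_def)

lemma coord_exists: "\<exists>f. linear f \<and> (\<forall>j\<in>{1..r}. f (\<alpha> j) = (if j = i then 1 else 0 :: real))"
proof -
  have inj: "inj_on \<alpha> {1..r}" and ind: "independent (\<alpha> ` {1..r})"
    using simple_roots by (auto simp: simple_roots_def)
  obtain f :: "'a \<Rightarrow> real" where f: "linear f"
    "\<And>x. x \<in> \<alpha> ` {1..r} \<Longrightarrow> f x = (if inv_into {1..r} \<alpha> x = i then 1 else 0)"
    using linear_independent_extend[OF ind, of "\<lambda>x. if inv_into {1..r} \<alpha> x = i then 1 else 0"]
    by blast
  show ?thesis
    using f inj by (intro exI[of _ f]) (auto simp: inv_into_f_f)
qed

lemma linear_coord: "linear (coord i)"
  and coord_simple_root: "j \<in> {1..r} \<Longrightarrow> coord i (\<alpha> j) = (if j = i then 1 else 0)"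
  using someI_ex[OF coord_exists] unfolding coord_def by blast+

lemmas coord_add = linear_add[OF linear_coord]
  and coord_diff = linear_diff[OF linear_coord]
  and coord_minus = linear_neg[OF linear_coord]
  and coord_scaleR = linear_scale[OF linear_coord]
  and coord_sum = linear_sum[OF linear_coord]
  and coord_zero = linear_0[OF linear_coord]

lemma coord_simple_sum:
  assumes "i \<in> {1..r}"
  shows "coord i (\<Sum>j=1..r. c j *\<^sub>R \<alpha> j) = c i"
proof -
  have "coord i (\<Sum>j=1..r. c j *\<^sub>R \<alpha> j) = (\<Sum>j=1..r. if j = i then c j else 0)"
    unfolding coord_sum by (intro sum.cong HOL.refl) (simp add: coord_scaleR coord_simple_root)
  also have "\<dots> = c i"
    using assms by simp
  finally show ?thesis .
qed

lemma root_coords: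
  assumes "\<beta> \<in> \<Phi>"
  obtains c :: "nat \<Rightarrow> nat" where "\<beta> = (\<Sum>i=1..r. of_nat (c i) *\<^sub>R \<alpha> i)"
    | c :: "nat \<Rightarrow> nat" where "\<beta> = - (\<Sum>i=1..r. of_nat (c i) *\<^sub>R \<alpha> i)"
  using assms simple_roots by (auto simp: simple_roots_def)

lemma coord_representation:
  assumes "v \<in> span \<Phi>"
  shows "v = (\<Sum>i=1..r. coord i v *\<^sub>R \<alpha> i)"
proof -
  have "linear (\<lambda>v. \<Sum>i=1..r. coord i v *\<^sub>R \<alpha> i)"
    by (intro linearI) (simp_all add: coord_add coord_scaleR scaleR_add_left sum.distrib scaleR_sum_right)
  moreover have "\<beta> = (\<Sum>i=1..r. coord i \<beta> *\<^sub>R \<alpha> i)" if "\<beta> \<in> \<Phi>" for \<beta>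
    using that
  proof (cases rule: root_coords)
    case (1 c)
    have "(\<Sum>i=1..r. coord i \<beta> *\<^sub>R \<alpha> i) = (\<Sum>i=1..r. of_nat (c i) *\<^sub>R \<alpha> i)"
      unfolding 1 by (intro sum.cong HOL.refl arg_cong2[where f = scaleR] coord_simple_sum)
    with 1 show ?thesis by simp
  next
    case (2 c)
    have "(\<Sum>i=1..r. coord i \<beta> *\<^sub>R \<alpha> i) = (\<Sum>i=1..r. (- of_nat (c i)) *\<^sub>R \<alpha> i)"
      unfolding 2 coord_minus by (intro sum.cong HOL.refl arg_cong2[where f = scaleR] arg_cong[where f = uminus] coord_simple_sum)
    with 2 show ?thesis by (simp add: sum_negf)
  qed
  ultimately show ?thesis
    by (intro linear_eq_on_span[OF linear_id[unfolded id_def] _ _ assms])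
qed

lemma coord_eqI:
  assumes "x \<in> span \<Phi>" "y \<in> span \<Phi>" "\<And>i. i \<in> {1..r} \<Longrightarrow> coord i x = coord i y"
  shows "x = y"
proof -
  have "(\<Sum>i=1..r. coord i x *\<^sub>R \<alpha> i) = (\<Sum>i=1..r. coord i y *\<^sub>R \<alpha> i)"
    using assms(3) by (intro sum.cong) auto
  then show ?thesis
    using coord_representation[OF assms(1)] coord_representation[OF assms(2)] by simp
qed

section \<open>Integrality and sign of root coordinates\<close>

lemma coord_root_Ints: "\<beta> \<in> \<Phi> \<Longrightarrow> i \<in> {1..r} \<Longrightarrow> coord i \<beta> \<in> \<int>"
  by (erule root_coords) (simp_all add: coord_minus coord_simple_sum del: atLeastAtMost_iff)

text \<open>On \<open>span \<Phi>\<close> this is membership in the cone generated by the simple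
  roots. For roots it means positivity; for differences it is the real form of the dominance
  order.\<close>

definition nonneg :: "'a \<Rightarrow> bool" where
  "nonneg v \<longleftrightarrow> (\<forall>i\<in>{1..r}. coord i v \<ge> 0)"

lemma root_nonneg_or: "\<beta> \<in> \<Phi> \<Longrightarrow> nonneg \<beta> \<or> nonneg (- \<beta>)"
  by (erule root_coords) (simp_all add: nonneg_def coord_minus coord_simple_sum del: atLeastAtMost_iff)

lemma nonneg_add: "nonneg x \<Longrightarrow> nonneg y \<Longrightarrow> nonneg (x + y)"
  and nonneg_scaleR: "0 \<le> c \<Longrightarrow> nonneg x \<Longrightarrow> nonneg (c *\<^sub>R x)"
  and nonneg_zero: "nonneg 0"
  by (simp_all add: nonneg_def coord_add coord_scaleR coord_zero)

lemma nonneg_antisym: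
  assumes "x \<in> span \<Phi>" "nonneg x" "nonneg (- x)"
  shows "x = 0"
  using assms by (intro coord_eqI) (auto simp: span_zero nonneg_def coord_minus coord_zero intro: antisym)

lemma root_nonneg_minus_iff:
  assumes "\<beta> \<in> \<Phi>"
  shows "nonneg (- \<beta>) \<longleftrightarrow> \<not> nonneg \<beta>"
  using assms root_nonneg_or nonneg_antisym root_nonzero span_base by blast

lemma nonneg_simple_root: "i \<in> {1..r} \<Longrightarrow> nonneg (\<alpha> i)"
  by (auto simp: nonneg_def coord_simple_root)

lemma coord_refl_along:
  assumes "i \<in> {1..r}" "j \<in> {1..r}" "i \<noteq> j"
  shows "coord i (refl_along (\<alpha> j) v) = coord i v"
  using assms by (simp add: refl_along_def coord_diff coord_scaleR coord_simple_root)

lemma simple_refl_root: "j \<in> {1..r} \<Longrightarrow> \<beta> \<in> \<Phi> \<Longrightarrow> refl_along (\<alpha> j) \<beta> \<in> \<Phi>"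
  using weyl_group_root[OF root_system weyl_group_refl_along[OF simple_root]] .

text \<open>A simple reflection alters only the \<open>j\<close>-th coordinate. A positive root
  other than \<open>\<alpha> j\<close> has another positive coordinate, which survives, and one
  positive coordinate rules out a negative root.\<close>

lemma nonneg_refl_along:
  assumes "\<beta> \<in> \<Phi>" "nonneg \<beta>" "j \<in> {1..r}" "\<beta> \<noteq> \<alpha> j"
  shows "nonneg (refl_along (\<alpha> j) \<beta>)"
proof -
  obtain i where i: "i \<in> {1..r}" "i \<noteq> j" "coord i \<beta> \<noteq> 0"
  proof (rule ccontr)
    assume "\<not> thesis"
    with that have *: "coord i \<beta> = 0" if "i \<in> {1..r}" "i \<noteq> j" for i
      using that by blast
    \<comment> \<open>Otherwise \<open>\<beta>\<close> is a multiple of \<open>\<alpha> j\<close>,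
      and reducedness leaves only \<open>\<alpha> j\<close> and its negative.\<close>
    have "\<beta> = coord j \<beta> *\<^sub>R \<alpha> j"
      using assms(1,3) by (intro coord_eqI)
        (auto simp: coord_scaleR coord_simple_root span_base simple_root span_scale *)
    then have "coord j \<beta> = 1 \<or> coord j \<beta> = -1"
      using root_system simple_root[OF assms(3)] assms(1) unfolding root_system_def by metis
    moreover have "coord j \<beta> \<ge> 0"
      using assms(2,3) by (auto simp: nonneg_def)
    ultimately show False
      using \<open>\<beta> = _\<close> assms(4) by auto
  qed
  then have "coord i (refl_along (\<alpha> j) \<beta>) > 0"
    using assms(2,3) by (auto simp: coord_refl_along nonneg_def less_le)
  then have "\<not> nonneg (- refl_along (\<alpha> j) \<beta>)"
    using i(1) by (force simp: nonneg_def coord_minus)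
  then show ?thesis
    using root_nonneg_or simple_refl_root assms by blast
qed

lemma nonneg_refl_along_iff:
  assumes "\<beta> \<in> \<Phi>" "j \<in> {1..r}" "\<beta> \<noteq> \<alpha> j" "\<beta> \<noteq> - \<alpha> j"
  shows "nonneg (refl_along (\<alpha> j) \<beta>) \<longleftrightarrow> nonneg \<beta>"
proof
  assume nn: "nonneg (refl_along (\<alpha> j) \<beta>)"
  have "refl_along (\<alpha> j) \<beta> \<noteq> \<alpha> j"
    using assms(2,4) refl_along_self[OF root_nonzero[OF simple_root]]
    by (metis refl_along_refl_along)
  with nonneg_refl_along[OF simple_refl_root[OF assms(2,1)] nn assms(2)] show "nonneg \<beta>"
    by simp
qed (use nonneg_refl_along assms in blast)

text \<open>The \<open>i\<close>-th coordinate of the positive root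
  \<open>refl_along (\<alpha> i) (\<alpha> j)\<close> is minus the Cartan number of the
  pair.\<close>

lemma simple_roots_obtuse:
  assumes "i \<in> {1..r}" "j \<in> {1..r}" "i \<noteq> j"
  shows "\<alpha> i \<bullet> \<alpha> j \<le> 0"
proof -
  have "nonneg (refl_along (\<alpha> i) (\<alpha> j))"
    using assms simple_root nonneg_simple_root coord_simple_root
    by (intro nonneg_refl_along) (auto, metis zero_neq_one)
  then have "coord i (refl_along (\<alpha> i) (\<alpha> j)) \<ge> 0"
    using assms by (auto simp: nonneg_def)
  then have "2 * (\<alpha> j \<bullet> \<alpha> i) / (\<alpha> i \<bullet> \<alpha> i) \<le> 0"
    using assms by (simp add: refl_along_def coord_diff coord_scaleR coord_simple_root)
  moreover have "\<alpha> i \<bullet> \<alpha> i > 0"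
    using root_nonzero[OF simple_root[OF assms(1)]] by simp
  ultimately show ?thesis
    by (simp add: divide_le_0_iff inner_commute)
qed

section \<open>Words in the simple reflections\<close>

text \<open>Index lists stand in for group elements so that arguments can descend on the length of
  an expression; expressions need not be reduced.\<close>

definition word :: "nat list \<Rightarrow> 'a \<Rightarrow> 'a" where
  "word us = foldr (\<lambda>i w. refl_along (\<alpha> i) \<circ> w) us id"

lemma word_Nil [simp]: "word [] = id"
  and word_Cons [simp]: "word (i # us) = refl_along (\<alpha> i) \<circ> word us"
  by (simp_all add: word_def)

lemma word_append: "word (us @ js) = word us \<circ> word js"
  by (induction us) (simp_all add: comp_assoc)

lemma word_weyl_group: "set us \<subseteq> {1..r} \<Longrightarrow> word us \<in> weyl_group \<Phi>"
  by (induction us) (auto intro!: weyl_group.intros simple_root simp del: atLeastAtMost_iff)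

lemma word_rev: "word (rev us) (word us x) = x"
  by (induction us) (simp_all add: word_append)

text \<open>Every positive root is carried to a simple one by lowering its height.\<close>

lemma simple_conjugate:
  assumes "\<beta> \<in> \<Phi>" "nonneg \<beta>"
  obtains us i where "set us \<subseteq> {1..r}" "i \<in> {1..r}" "word us \<beta> = \<alpha> i"
proof -
  define height where "height v = (\<Sum>i=1..r. coord i v)" for v
  define X where "X = {\<gamma>\<in>\<Phi>. nonneg \<gamma> \<and> (\<exists>us. set us \<subseteq> {1..r} \<and> word us \<beta> = \<gamma>)}"
  have "finite X"
    using root_system by (auto simp: X_def root_system_def)
  moreover have "\<beta> \<in> X"
    using assms unfolding X_def by (auto intro: exI[of _ "[]"])
  ultimately obtain \<gamma> where \<gamma>: "\<gamma> \<in> X" "\<And>\<delta>. \<delta> \<in> X \<Longrightarrow> height \<gamma> \<le> height \<delta>"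
    using ex_min_if_finite[of "height ` X"] by (force simp: not_less)
  obtain us where us: "set us \<subseteq> {1..r}" "word us \<beta> = \<gamma>" and nn: "nonneg \<gamma>" and \<gamma>_root: "\<gamma> \<in> \<Phi>"
    using \<gamma>(1) by (auto simp: X_def)
  \<comment> \<open>If no simple root had positive inner product with \<open>\<gamma>\<close>,
    expanding \<open>\<gamma>\<close> in its nonnegative coordinates would give
    \<open>\<gamma> \<bullet> \<gamma> \<le> 0\<close>.\<close>
  have "\<exists>j\<in>{1..r}. 0 < \<gamma> \<bullet> \<alpha> j"
  proof (rule ccontr)
    assume "\<not> ?thesis"
    then have *: "\<gamma> \<bullet> \<alpha> j \<le> 0" if "j \<in> {1..r}" for j
      using that by force
    have "\<gamma> \<bullet> \<gamma> = \<gamma> \<bullet> (\<Sum>i=1..r. coord i \<gamma> *\<^sub>R \<alpha> i)"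
      using coord_representation[of \<gamma>] \<gamma>_root by (simp add: span_base)
    also have "\<dots> = (\<Sum>i=1..r. coord i \<gamma> * (\<gamma> \<bullet> \<alpha> i))"
      by (simp add: inner_sum_right)
    also have "\<dots> \<le> 0"
      using nn * by (intro sum_nonpos mult_nonneg_nonpos) (auto simp: nonneg_def)
    finally show False
      using root_nonzero[OF \<gamma>_root] by (simp flip: not_less)
  qed
  then obtain j where j: "j \<in> {1..r}" "0 < \<gamma> \<bullet> \<alpha> j"
    by blast
  \<comment> \<open>Otherwise the reflection in \<open>\<alpha> j\<close> keeps the root in
    \<open>X\<close> but subtracts a positive multiple of \<open>\<alpha> j\<close>, against
    minimality of the height.\<close>
  have "\<gamma> = \<alpha> j"
  proof (rule ccontr)
    assume "\<gamma> \<noteq> \<alpha> j"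
    then have "nonneg (refl_along (\<alpha> j) \<gamma>)"
      using nonneg_refl_along \<gamma>_root nn j by blast
    moreover have "set (j # us) \<subseteq> {1..r} \<and> word (j # us) \<beta> = refl_along (\<alpha> j) \<gamma>"
      using us j by simp
    ultimately have "refl_along (\<alpha> j) \<gamma> \<in> X"
      unfolding X_def using simple_refl_root[OF j(1) \<gamma>_root] by blast
    then have "height \<gamma> \<le> height (refl_along (\<alpha> j) \<gamma>)"
      by (rule \<gamma>(2))
    also have "\<dots> = height \<gamma> - (2 * (\<gamma> \<bullet> \<alpha> j) / (\<alpha> j \<bullet> \<alpha> j)) * height (\<alpha> j)"
      by (simp add: height_def refl_along_def coord_diff coord_scaleR sum_subtractf sum_distrib_left)
    also have "height (\<alpha> j) = 1"
      using j(1) by (simp add: height_def coord_simple_root)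
    finally have "2 * (\<gamma> \<bullet> \<alpha> j) / (\<alpha> j \<bullet> \<alpha> j) \<le> 0"
      by simp
    moreover have "\<alpha> j \<bullet> \<alpha> j > 0"
      using root_nonzero[OF simple_root[OF j(1)]] by simp
    ultimately show False
      using j(2) by (simp add: divide_le_0_iff)
  qed
  with us j that show thesis
    by blast
qed

text \<open>It suffices to treat one reflection. A positive root is conjugate to a simple one by a
  word, so its reflection is conjugate to a simple reflection by that word; \<open>\<beta>\<close>
  and \<open>- \<beta>\<close> give the same reflection.\<close>

lemma weyl_group_word:
  assumes "w \<in> weyl_group \<Phi>"
  obtains us where "set us \<subseteq> {1..r}" "w = word us"
proof -
  have positive: "\<exists>us. set us \<subseteq> {1..r} \<and> refl_along \<beta> = word us" if "\<beta> \<in> \<Phi>" "nonneg \<beta>" for \<beta>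
  proof -
    obtain ks i where ks: "set ks \<subseteq> {1..r}" "i \<in> {1..r}" "word ks \<beta> = \<alpha> i"
      using simple_conjugate \<open>\<beta> \<in> \<Phi>\<close> \<open>nonneg \<beta>\<close> by blast
    have "word (rev ks @ i # ks) x = refl_along \<beta> x" for x
    proof -
      have "word (rev ks @ i # ks) x = word (rev ks) (refl_along (word ks \<beta>) (word ks x))"
        by (simp add: word_append ks)
      also have "\<dots> = word (rev ks) (word ks (refl_along \<beta> x))"
        using orthogonal_transformation_refl_along_conj weyl_group_orthogonal word_weyl_group ks(1)
        by metis
      finally show ?thesis
        by (simp add: word_rev)
    qed
    with ks(1,2) show ?thesis
      by (intro exI[of _ "rev ks @ i # ks"]) (auto simp: fun_eq_iff)
  qed
  have "\<exists>us. set us \<subseteq> {1..r} \<and> w = word us"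
    using assms
  proof (induction rule: weyl_group.induct)
    case id
    then show ?case by (intro exI[of _ "[]"]) simp
  next
    case (refl \<beta> w)
    obtain ks where ks: "set ks \<subseteq> {1..r}" "refl_along \<beta> = word ks"
    proof (cases "nonneg \<beta>")
      case True
      with refl.hyps that show thesis
        using positive by blast
    next
      case False
      then have "nonneg (- \<beta>)" "- \<beta> \<in> \<Phi>"
        using refl.hyps root_nonneg_or root_minus root_system by blast+
      with that show thesis
        using positive
        by (metis refl_along_minus)
    qed
    moreover obtain js where "set js \<subseteq> {1..r}" "w = word js"
      using refl.IH by blast
    ultimately show ?case
      by (intro exI[of _ "ks @ js"]) (simp add: word_append)
  qed
  then show thesis
    using that by blast
qed

text \<open>As the letters act on \<open>\<alpha> j\<close> from the right end of the word, some
  letter \<open>i\<close> turns a positive image negative. That image must be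
  \<open>\<alpha> i\<close>, so this letter and the appended \<open>j\<close> cancel.\<close>

lemma exchange:
  assumes "set us \<subseteq> {1..r}" "j \<in> {1..r}" "\<not> nonneg (word us (\<alpha> j))"
  obtains js where "set js \<subseteq> {1..r}" "length js < length us" "word (us @ [j]) = word js"
proof -
  have "\<exists>js. set js \<subseteq> {1..r} \<and> length js < length us \<and> word (us @ [j]) = word js"
    using assms
  proof (induction us)
    case Nil
    then show ?case by (simp add: nonneg_simple_root)
  next
    case (Cons i us)
    show ?case
    proof (cases "nonneg (word us (\<alpha> j))")
      case False
      with Cons obtain js where "set js \<subseteq> {1..r}" "length js < length us" "word (us @ [j]) = word js"
        by auto
      with Cons.prems show ?thesis
        by (intro exI[of _ "i # js"]) auto
    next
      case True
      have W: "word us \<in> weyl_group \<Phi>"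
        using Cons.prems by (intro word_weyl_group) auto
      \<comment> \<open>\<open>\<alpha> i\<close> is the only positive root that its own reflection
        makes negative.\<close>
      have eq: "word us (\<alpha> j) = \<alpha> i"
        using Cons.prems True nonneg_refl_along[OF weyl_group_root[OF root_system W simple_root]]
        by auto
      have "word (i # us @ [j]) x = word us x" for x
      proof -
        have "word (i # us @ [j]) x = refl_along (\<alpha> i) (word us (refl_along (\<alpha> j) x))"
          by (simp add: word_append)
        also have "word us (refl_along (\<alpha> j) x) = refl_along (\<alpha> i) (word us x)"
          using orthogonal_transformation_refl_along_conj[OF weyl_group_orthogonal[OF W]] eq by simp
        finally show ?thesis by simp
      qed
      then have "word ((i # us) @ [j]) = word us"
        by (simp add: fun_eq_iff)
      with Cons.prems show ?thesis
        by (intro exI[of _ us]) auto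
    qed
  qed
  then show thesis
    using that by blast
qed

text \<open>Induction on word length. If the word ends in \<open>j\<close>, positivity of
  \<open>w (\<alpha> j)\<close> says that the word without its last letter makes
  \<open>\<alpha> j\<close> negative, so \<open>exchange\<close> yields a shorter word for
  \<open>w\<close>.\<close>

lemma weyl_group_eq_id:
  assumes "w \<in> weyl_group \<Phi>" "\<And>i. i \<in> {1..r} \<Longrightarrow> nonneg (w (\<alpha> i))"
  shows "w = id"
proof -
  obtain ks where ks: "set ks \<subseteq> {1..r}" "w = word ks"
    using weyl_group_word assms(1) by blast
  then show ?thesis
  proof (induction ks rule: length_induct)
    case (1 ks)
    show ?case
    proof (cases ks rule: rev_cases)
      case Nil
      with 1 show ?thesis by simp
    next
      case (snoc us j)
      then have j: "set us \<subseteq> {1..r}" "j \<in> {1..r}"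
        using 1 by auto
      have W: "word us \<in> weyl_group \<Phi>"
        using j by (intro word_weyl_group)
      have "w (\<alpha> j) = word us (refl_along (\<alpha> j) (\<alpha> j))"
        using 1 snoc by (simp add: word_append)
      also have "\<dots> = - word us (\<alpha> j)"
        using root_nonzero[OF simple_root[OF j(2)]] linear_neg[OF weyl_group_linear[OF W]]
        by (simp add: refl_along_self)
      finally have "nonneg (- word us (\<alpha> j))"
        using assms(2)[OF j(2)] by simp
      then have "\<not> nonneg (word us (\<alpha> j))"
        using root_nonneg_minus_iff weyl_group_root[OF root_system W simple_root[OF j(2)]] by blast
      with j obtain js where js: "set js \<subseteq> {1..r}" "length js < length us" "word (us @ [j]) = word js"
        using exchange by blast
      with 1 snoc show ?thesis by force
    qed
  qed
qed

section \<open>Dominant vectors and their Weyl orbits\<close>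

lemma dominant_inner_nonneg:
  assumes "dominant r \<alpha> x" "y \<in> span \<Phi>" "nonneg y"
  shows "x \<bullet> y \<ge> 0"
proof -
  have "x \<bullet> y = x \<bullet> (\<Sum>i=1..r. coord i y *\<^sub>R \<alpha> i)"
    using coord_representation[OF assms(2)] by simp
  also have "\<dots> = (\<Sum>i=1..r. coord i y * (x \<bullet> \<alpha> i))"
    by (simp add: inner_sum_right)
  finally show ?thesis
    using assms by (auto simp: dominant_def nonneg_def intro!: sum_nonneg mult_nonneg_nonneg)
qed

text \<open>Dropping the last letter \<open>j\<close> of a word for \<open>w\<close> leaves some
  \<open>u\<close>, and \<open>w x\<close> is \<open>u x\<close> minus a nonnegative multiple of
  \<open>u (\<alpha> j)\<close>. If that root is positive, the bound for \<open>u\<close> carries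
  over; otherwise \<open>exchange\<close> gives a shorter word for \<open>w\<close>.\<close>

lemma dominant_diff_nonneg:
  assumes "dominant r \<alpha> x" "w \<in> weyl_group \<Phi>"
  shows "nonneg (x - w x)"
proof -
  obtain ks where ks: "set ks \<subseteq> {1..r}" "w = word ks"
    using weyl_group_word assms(2) by blast
  then show ?thesis
  proof (induction ks arbitrary: w rule: length_induct)
    case (1 ks)
    show ?case
    proof (cases ks rule: rev_cases)
      case Nil
      with 1 show ?thesis by (simp add: nonneg_zero)
    next
      case (snoc us j)
      then have j: "set us \<subseteq> {1..r}" "j \<in> {1..r}"
        using 1 by auto
      have W: "word us \<in> weyl_group \<Phi>"
        using j by (intro word_weyl_group)
      show ?thesis
      proof (cases "nonneg (word us (\<alpha> j))")
        case False
        with j obtain js where "set js \<subseteq> {1..r}" "length js < length us" "word (us @ [j]) = word js"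
          using exchange by blast
        with 1 snoc show ?thesis by force
      next
        case True
        have "w x = word us x - (2 * (x \<bullet> \<alpha> j) / (\<alpha> j \<bullet> \<alpha> j)) *\<^sub>R word us (\<alpha> j)"
          using 1 snoc weyl_group_linear[OF W]
          by (simp add: word_append refl_along_def linear_diff linear_scale)
        then have "x - w x = (x - word us x) + (2 * (x \<bullet> \<alpha> j) / (\<alpha> j \<bullet> \<alpha> j)) *\<^sub>R word us (\<alpha> j)"
          by simp
        moreover have "nonneg (x - word us x)"
          using 1 snoc j by auto
        moreover have "2 * (x \<bullet> \<alpha> j) / (\<alpha> j \<bullet> \<alpha> j) \<ge> 0"
          using assms(1) j(2) by (simp add: dominant_def)
        ultimately show ?thesis
          using True nonneg_add nonneg_scaleR by metis
      qed
    qed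
  qed
qed

text \<open>An orbit point of maximal height is dominant, since a negative inner product with a
  simple root would let its reflection raise the height. Only changes of height matter, so
  \<open>x\<close> may lie outside \<open>span \<Phi>\<close>.\<close>

lemma dominant_representative:
  obtains w where "w \<in> weyl_group \<Phi>" "dominant r \<alpha> (w x)"
proof -
  define height where "height v = (\<Sum>i=1..r. coord i v)" for v
  have "finite (weyl_group \<Phi>)" "weyl_group \<Phi> \<noteq> {}"
    using finite_weyl_group[OF root_system] weyl_group.id by auto
  then obtain w where w: "w \<in> weyl_group \<Phi>"
    "\<And>v. v \<in> weyl_group \<Phi> \<Longrightarrow> height (v x) \<le> height (w x)"
    using Max_in[of "(\<lambda>w. height (w x)) ` weyl_group \<Phi>"]
      Max_ge[of "(\<lambda>w. height (w x)) ` weyl_group \<Phi>"] by fastforce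
  have "dominant r \<alpha> (w x)"
    unfolding dominant_def
  proof
    fix j assume j: "j \<in> {1..r}"
    have "height (w x) \<ge> height ((refl_along (\<alpha> j) \<circ> w) x)"
      by (rule w(2)[OF weyl_group.refl[OF simple_root[OF j] w(1)]])
    also have "height ((refl_along (\<alpha> j) \<circ> w) x) =
        height (w x) - (2 * (w x \<bullet> \<alpha> j) / (\<alpha> j \<bullet> \<alpha> j)) * height (\<alpha> j)"
      by (simp add: height_def refl_along_def coord_diff coord_scaleR sum_subtractf sum_distrib_left)
    also have "height (\<alpha> j) = 1"
      using j by (simp add: height_def coord_simple_root)
    finally have "2 * (w x \<bullet> \<alpha> j) / (\<alpha> j \<bullet> \<alpha> j) \<ge> 0"
      by simp
    moreover have "\<alpha> j \<bullet> \<alpha> j > 0"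
      using root_nonzero[OF simple_root[OF j]] by simp
    ultimately show "w x \<bullet> \<alpha> j \<ge> 0"
      by (simp add: zero_le_divide_iff)
  qed
  with w(1) that show thesis by blast
qed

section \<open>The weight polytope\<close>

lemma weight_polytope_weyl_image:
  assumes "w \<in> weyl_group \<Phi>" "\<mu> \<in> weight_polytope \<Phi> v"
  shows "w \<mu> \<in> weight_polytope \<Phi> v"
proof -
  let ?S = "{u v |u. u \<in> weyl_group \<Phi>}"
  have "w \<mu> \<in> w ` (convex hull ?S)"
    using assms(2) by (auto simp: weight_polytope_def)
  also have "\<dots> = convex hull (w ` ?S)"
    by (rule convex_hull_linear_image[OF weyl_group_linear[OF assms(1)]])
  also have "\<dots> \<subseteq> convex hull ?S"
  proof (rule hull_mono)
    have "w (u v) \<in> ?S" if "u \<in> weyl_group \<Phi>" for u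
      using weyl_group_comp[OF assms(1) that] by (auto intro!: exI[of _ "w \<circ> u"])
    then show "w ` ?S \<subseteq> ?S" by blast
  qed
  finally show ?thesis by (simp add: weight_polytope_def)
qed

text \<open>The whole orbit lies in the convex cone below \<open>v\<close>, which gives one
  direction. For the other, a functional separating \<open>\<mu>\<close> from the polytope is
  conjugated into the dominant chamber, where it contradicts the cone condition.\<close>

lemma dominant_mem_weight_polytope_iff:
  assumes "dominant r \<alpha> v" "dominant r \<alpha> \<mu>" "v - \<mu> \<in> span \<Phi>"
  shows "\<mu> \<in> weight_polytope \<Phi> v \<longleftrightarrow> nonneg (v - \<mu>)"
proof
  let ?C = "{\<mu>. nonneg (v - \<mu>)}"
  have "convex ?C"
  proof (rule convexI)
    fix x y :: 'a and a b :: real assume *: "x \<in> ?C" "y \<in> ?C" "0 \<le> a" "0 \<le> b" "a + b = 1"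
    have "v - (a *\<^sub>R x + b *\<^sub>R y) = (a + b) *\<^sub>R v - (a *\<^sub>R x + b *\<^sub>R y)"
      using * by simp
    also have "\<dots> = a *\<^sub>R (v - x) + b *\<^sub>R (v - y)"
      by (simp only: algebra_simps)
    finally show "a *\<^sub>R x + b *\<^sub>R y \<in> ?C"
      using * by (simp add: nonneg_add nonneg_scaleR)
  qed
  moreover have "{w v |w. w \<in> weyl_group \<Phi>} \<subseteq> ?C"
    using dominant_diff_nonneg[OF assms(1)] by auto
  ultimately show "nonneg (v - \<mu>)" if "\<mu> \<in> weight_polytope \<Phi> v"
    using that hull_minimal[of _ ?C convex] unfolding weight_polytope_def by blast
next
  assume nn: "nonneg (v - \<mu>)"
  show "\<mu> \<in> weight_polytope \<Phi> v"
  proof (rule ccontr)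
    assume not_in: "\<mu> \<notin> weight_polytope \<Phi> v"
    have "{w v |w. w \<in> weyl_group \<Phi>} = (\<lambda>w. w v) ` weyl_group \<Phi>"
      by blast
    then have "compact (weight_polytope \<Phi> v)"
      using finite_weyl_group[OF root_system]
      by (simp add: weight_polytope_def finite_imp_compact_convex_hull)
    then obtain a b where ab: "a \<bullet> \<mu> < b" "\<And>x. x \<in> weight_polytope \<Phi> v \<Longrightarrow> b < a \<bullet> x"
      using separating_hyperplane_closed_point[OF _ compact_imp_closed not_in]
      by (auto simp: weight_polytope_def)
    \<comment> \<open>\<open>- a\<close> is larger at \<open>\<mu>\<close> than anywhere on the
      polytope. For its dominant conjugate \<open>y\<close>, the number \<open>y \<bullet> v\<close>
      is the value of \<open>- a\<close> at the orbit point \<open>inv u v\<close>, and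
      \<open>y \<bullet> \<mu>\<close> is at least the value at \<open>\<mu>\<close>, because
      \<open>y\<close> exceeds \<open>- a\<close> by an element of the positive cone.\<close>
    obtain u where u: "u \<in> weyl_group \<Phi>" "dominant r \<alpha> (u (- a))"
      using dominant_representative by blast
    define y where "y = u (- a)"
    have a: "- a = inv u y"
      using u(1) by (simp add: y_def)
    have "inv u v \<in> weight_polytope \<Phi> v"
      unfolding weight_polytope_def using weyl_group_inv[OF u(1)] by (intro hull_inc) blast
    then have "(- a) \<bullet> inv u v < (- a) \<bullet> \<mu>"
      using ab(1) ab(2)[of "inv u v"] by simp
    also have "(- a) \<bullet> inv u v = y \<bullet> v"
      using weyl_group_inner[OF weyl_group_inv[OF u(1)], of y v] by (simp add: a)
    also have "(- a) \<bullet> \<mu> \<le> y \<bullet> \<mu>"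
    proof -
      have "nonneg (y - inv u y)"
        using u by (intro dominant_diff_nonneg weyl_group_inv) (auto simp: y_def)
      moreover have "y - inv u y \<in> span \<Phi>"
        using weyl_group_diff_span[OF weyl_group_inv[OF u(1)], of y] span_neg by fastforce
      ultimately have "\<mu> \<bullet> (y - inv u y) \<ge> 0"
        using assms(2) dominant_inner_nonneg by blast
      then show ?thesis
        by (simp add: a inner_diff_right inner_commute)
    qed
    finally have "y \<bullet> (v - \<mu>) < 0"
      by (simp add: inner_diff_right)
    moreover have "y \<bullet> (v - \<mu>) \<ge> 0"
      using dominant_inner_nonneg[OF _ assms(3) nn] u(2) by (simp add: y_def)
    ultimately show False by simp
  qed
qed

section \<open>Signed cone indicators\<close>

text \<open>
  The generating function of the positive half-line, \<open>1 / (1 - e\<^sup>-\<^sup>\<alpha>)\<close>, also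
  expands in the opposite direction; the two expansions are the two values of the flag.
\<close>

definition ray :: "bool \<Rightarrow> real \<Rightarrow> int" where
  "ray p c = (if p then of_bool (c \<ge> 0) else - of_bool (c < 0))"

text \<open>The coordinates of \<open>v - inv w \<mu>\<close> are the coefficients in writing
  \<open>\<mu>\<close> as \<open>w v\<close> minus a combination of the
  \<open>w (\<alpha> i)\<close>. So this is the coefficient of \<open>e^\<mu>\<close> in the summand
  for \<open>w\<close>, every factor being expanded along negative roots; integrality is imposed
  only in \<open>cone_fun\<close>.\<close>

definition cone_term :: "'a \<Rightarrow> ('a \<Rightarrow> 'a) \<Rightarrow> 'a \<Rightarrow> int" where
  "cone_term v w \<mu> = (\<Prod>i=1..r. ray (nonneg (w (\<alpha> i))) (coord i (v - inv w \<mu>)))"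

definition cone_sum :: "'a \<Rightarrow> 'a \<Rightarrow> int" where
  "cone_sum v \<mu> = (\<Sum>w\<in>weyl_group \<Phi>. cone_term v w \<mu>)"

text \<open>The two expansions differ by a series over the whole line, so the difference does not
  depend on \<open>c\<close>. This is why a coordinate drops out in the cancellation below.\<close>

lemma ray_diff: "ray p c - ray (\<not> p) c = (if p then 1 else -1)"
  by (simp add: ray_def)

text \<open>
  After reindexing, the difference of the two sides is a sum whose terms for \<open>w\<close> and
  \<open>s\<^sub>j w\<close> cancel: they are nonzero only if \<open>w \<alpha>\<^sub>i = \<plusminus> \<alpha>\<^sub>j\<close> for some
  \<open>i\<close>, and then they do not involve the \<open>i\<close>-th coordinate.
\<close>

lemma cone_sum_simple_refl:
  assumes j: "j \<in> {1..r}"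
  shows "cone_sum v (refl_along (\<alpha> j) \<mu>) = cone_sum v \<mu>"
proof -
  let ?W = "weyl_group \<Phi>" and ?s = "refl_along (\<alpha> j)"
  \<comment> \<open>\<open>t\<close> compares a term at \<open>\<mu>\<close> with the reindexed term
    at the reflected point; the sum of all \<open>t w\<close> has to vanish.\<close>
  define t where "t w = cone_term v w \<mu> - cone_term v (?s \<circ> w) (?s \<mu>)" for w
  have sW: "?s \<circ> w \<in> ?W" if "w \<in> ?W" for w
    using weyl_group.refl[OF simple_root[OF j] that] .
  have inv_s: "inv (?s \<circ> w) x = inv w (?s x)" if "w \<in> ?W" for w x
  proof -
    have "inv (?s \<circ> w) x = inv (?s \<circ> w) ((?s \<circ> w) (inv w (?s x)))"
      using that by simp
    also have "\<dots> = inv w (?s x)"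
      using weyl_group_inv_apply(2)[OF sW[OF that]] .
    finally show ?thesis .
  qed
  have ss: "?s \<circ> (?s \<circ> w) = w" for w :: "'a \<Rightarrow> 'a"
    by (simp add: fun_eq_iff)
  have reindex: "(\<Sum>w\<in>?W. f (?s \<circ> w)) = (\<Sum>w\<in>?W. f w)" for f :: "('a \<Rightarrow> 'a) \<Rightarrow> int"
    by (rule sum.reindex_bij_witness[of _ "\<lambda>w. ?s \<circ> w" "\<lambda>w. ?s \<circ> w"]) (use sW ss in auto)
  have t_eq: "t w = (\<Prod>i=1..r. ray (nonneg (w (\<alpha> i))) (coord i (v - inv w \<mu>)))
      - (\<Prod>i=1..r. ray (nonneg (?s (w (\<alpha> i)))) (coord i (v - inv w \<mu>)))" if "w \<in> ?W" for w
    using that by (simp add: t_def cone_term_def inv_s del: o_apply) simp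
  have t_eq': "t (?s \<circ> w) = (\<Prod>i=1..r. ray (nonneg (?s (w (\<alpha> i)))) (coord i (v - inv w (?s \<mu>))))
      - (\<Prod>i=1..r. ray (nonneg (w (\<alpha> i))) (coord i (v - inv w (?s \<mu>))))" if "w \<in> ?W" for w
    using t_eq[OF sW[OF that]] inv_s[OF that] by simp
  have "t (?s \<circ> w) = - t w" if w: "w \<in> ?W" for w
  proof (cases "\<exists>i\<in>{1..r}. w (\<alpha> i) = \<alpha> j \<or> w (\<alpha> i) = - \<alpha> j")
    \<comment> \<open>No flag changes, so the two products in \<open>t w\<close> coincide, and
      \<open>t w\<close> and \<open>t (?s \<circ> w)\<close> are both zero.\<close>
    case False
    then have "nonneg (?s (w (\<alpha> i))) = nonneg (w (\<alpha> i))" if "i \<in> {1..r}" for i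
      using that j weyl_group_root[OF root_system w simple_root[OF that]] nonneg_refl_along_iff by blast
    then show ?thesis
      by (simp add: t_eq[OF w] t_eq'[OF w])
  next
    case True
    then obtain i where i: "i \<in> {1..r}" "w (\<alpha> i) = \<alpha> j \<or> w (\<alpha> i) = - \<alpha> j"
      by blast
    have root: "w (\<alpha> k) \<in> \<Phi>" if "k \<in> {1..r}" for k
      using that weyl_group_root[OF root_system w simple_root] by blast
    have neg: "?s (w (\<alpha> i)) = - w (\<alpha> i)"
      using i(2) refl_along_self[OF root_nonzero[OF simple_root[OF j]]]
        linear_neg[OF orthogonal_transformation_linear[OF orthogonal_transformation_refl_along[of "\<alpha> j"]]]
      by auto
    \<comment> \<open>Linear independence keeps \<open>w (\<alpha> k)\<close> off the line through
      \<open>\<alpha> j\<close>, so only the \<open>i\<close>-th flag flips.\<close>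
    have other: "nonneg (?s (w (\<alpha> k))) = nonneg (w (\<alpha> k))" if k: "k \<in> {1..r} - {i}" for k
    proof -
      have "w (\<alpha> k) \<noteq> c *\<^sub>R w (\<alpha> i)" for c
      proof
        assume "w (\<alpha> k) = c *\<^sub>R w (\<alpha> i)"
        then have "inv w (w (\<alpha> k)) = inv w (w (c *\<^sub>R \<alpha> i))"
          using linear_scale[OF weyl_group_linear[OF w]] by simp
        then have "\<alpha> k = c *\<^sub>R \<alpha> i"
          using w by simp
        then have "coord k (\<alpha> k) = coord k (c *\<^sub>R \<alpha> i)"
          by simp
        then show False
          using k i(1) by (simp add: coord_scaleR coord_simple_root)
      qed
      from this[of 1] this[of "-1"] have "w (\<alpha> k) \<noteq> \<alpha> j" "w (\<alpha> k) \<noteq> - \<alpha> j"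
        using i(2) by auto
      then show ?thesis
        using nonneg_refl_along_iff[OF root j] k by auto
    qed
    \<comment> \<open>Pulled back by \<open>inv w\<close>, the reflection becomes the one in
      \<open>\<alpha> i\<close>, which moves only the \<open>i\<close>-th coordinate.\<close>
    have coord_other: "coord k (v - inv w (?s \<mu>)) = coord k (v - inv w \<mu>)" if k: "k \<in> {1..r} - {i}" for k
    proof -
      have "inv w (?s \<mu>) = refl_along (inv w (\<alpha> j)) (inv w \<mu>)"
        by (rule orthogonal_transformation_refl_along_conj[OF weyl_group_orthogonal[OF weyl_group_inv[OF w]]])
      also have "inv w (\<alpha> j) = \<alpha> i \<or> inv w (\<alpha> j) = - \<alpha> i"
        using i(2) w linear_neg[OF weyl_group_linear[OF w]]
        by (metis minus_minus weyl_group_inv_apply(2))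
      then have "refl_along (inv w (\<alpha> j)) (inv w \<mu>) = refl_along (\<alpha> i) (inv w \<mu>)"
        by (auto simp: refl_along_minus)
      finally show ?thesis
        using k i(1) by (simp add: coord_diff coord_refl_along)
    qed
    define A where "A = (\<Prod>k\<in>{1..r} - {i}. ray (nonneg (w (\<alpha> k))) (coord k (v - inv w \<mu>)))"
    define p where "p = nonneg (w (\<alpha> i))"
    have p': "nonneg (?s (w (\<alpha> i))) = (\<not> p)"
      using root_nonneg_minus_iff[OF root[OF i(1)]] by (simp add: neg p_def)
    have "t w = (ray p (coord i (v - inv w \<mu>)) - ray (\<not> p) (coord i (v - inv w \<mu>))) * A"
      unfolding t_eq[OF w] using i(1) by (simp add: prod.remove p' p_def A_def other left_diff_distrib del: atLeastAtMost_iff)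
    moreover have "t (?s \<circ> w) =
        (ray (\<not> p) (coord i (v - inv w (?s \<mu>))) - ray p (coord i (v - inv w (?s \<mu>)))) * A"
      unfolding t_eq'[OF w] using i(1)
      by (simp add: prod.remove p' p_def A_def other coord_other left_diff_distrib del: atLeastAtMost_iff)
    \<comment> \<open>By \<open>ray_diff\<close> the two bracketed differences are \<open>1\<close>
      and \<open>-1\<close> in some order, whatever the coordinates.\<close>
    ultimately show ?thesis
      using ray_diff[of p "coord i (v - inv w \<mu>)"] ray_diff[of "\<not> p" "coord i (v - inv w (?s \<mu>))"]
      by (cases p) simp_all
  qed
  then have "(\<Sum>w\<in>?W. t w) = - (\<Sum>w\<in>?W. t w)"
    using reindex[of t] by (simp add: sum_negf)
  then have "(\<Sum>w\<in>?W. t w) = 0" by simp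
  then show ?thesis
    using reindex[of "\<lambda>w. cone_term v w (?s \<mu>)"] by (simp add: t_def sum_subtractf cone_sum_def)
qed

lemma cone_sum_weyl:
  assumes "w \<in> weyl_group \<Phi>"
  shows "cone_sum v (w \<mu>) = cone_sum v \<mu>"
proof -
  obtain us where "set us \<subseteq> {1..r}" "w = word us"
    using weyl_group_word assms by blast
  then show ?thesis
    by (induction us arbitrary: w) (auto simp: cone_sum_simple_refl simp del: atLeastAtMost_iff)
qed

text \<open>
  Langlands' combinatorial lemma: with \<open>x\<close> the negative part of \<open>v - w\<inverse> \<mu>\<close>, the
  inner product of \<open>x\<close> with \<open>v - w\<inverse> \<mu>\<close> is both nonnegative and at most
  \<open>- x \<bullet> x\<close>.
\<close>

lemma cone_term_dominant:
  assumes "dominant r \<alpha> v" "dominant r \<alpha> \<mu>" "v - \<mu> \<in> span \<Phi>"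
    and w: "w \<in> weyl_group \<Phi>" and nz: "cone_term v w \<mu> \<noteq> 0"
  shows "w = id"
proof (rule weyl_group_eq_id[OF w])
  define d where "d = v - inv w \<mu>"
  \<comment> \<open>Since no factor of the term vanishes, \<open>J\<close> is exactly the set of
    indices at which \<open>d\<close> has a negative coordinate.\<close>
  define J where "J = {i\<in>{1..r}. \<not> nonneg (w (\<alpha> i))}"
  define x where "x = (\<Sum>i\<in>J. (- coord i d) *\<^sub>R \<alpha> i)"
  have ray: "ray (nonneg (w (\<alpha> i))) (coord i d) \<noteq> 0" if "i \<in> {1..r}" for i
    using nz that by (auto simp: cone_term_def d_def)
  have neg: "coord i d < 0" if "i \<in> J" for i
    using ray[of i] that by (auto simp: J_def ray_def split: if_splits)
  have nonneg: "coord i d \<ge> 0" if "i \<in> {1..r} - J" for i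
    using ray[of i] that by (auto simp: J_def ray_def split: if_splits)
  have "d = (v - \<mu>) - (inv w \<mu> - \<mu>)"
    by (simp add: d_def)
  also have "\<dots> \<in> span \<Phi>"
    by (intro span_diff assms weyl_group_diff_span weyl_group_inv)
  finally have "d = (\<Sum>i=1..r. coord i d *\<^sub>R \<alpha> i)"
    by (rule coord_representation)
  also have "\<dots> = (\<Sum>i\<in>{1..r} - J. coord i d *\<^sub>R \<alpha> i) + (\<Sum>i\<in>J. coord i d *\<^sub>R \<alpha> i)"
    by (rule sum.subset_diff) (auto simp: J_def)
  also have "\<dots> = (\<Sum>i\<in>{1..r} - J. coord i d *\<^sub>R \<alpha> i) - x"
    by (simp add: x_def sum_negf)
  finally have d: "d = (\<Sum>i\<in>{1..r} - J. coord i d *\<^sub>R \<alpha> i) - x" .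
  have "(\<Sum>i\<in>{1..r} - J. coord i d *\<^sub>R \<alpha> i) \<bullet> x =
      (\<Sum>i\<in>{1..r} - J. \<Sum>k\<in>J. coord i d * ((- coord k d) * (\<alpha> i \<bullet> \<alpha> k)))"
    by (simp only: inner_sum_left inner_scaleR_left)
      (simp add: x_def inner_sum_right sum_distrib_left)
  \<comment> \<open>Each product combines nonnegative coefficients with two distinct simple roots,
    which never form an acute angle.\<close>
  also have "\<dots> \<le> 0"
  proof (intro sum_nonpos mult_nonneg_nonpos)
    fix i k assume "i \<in> {1..r} - J" "k \<in> J"
    then show "\<alpha> i \<bullet> \<alpha> k \<le> 0" "0 \<le> coord i d" "0 \<le> - coord k d"
      using simple_roots_obtuse[of i k] neg[of k] nonneg[of i] by (auto simp: J_def)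
  qed
  finally have "d \<bullet> x \<le> - (x \<bullet> x)"
    by (subst d) (simp add: inner_diff_left)
  moreover have "d \<bullet> x \<ge> 0"
  proof -
    \<comment> \<open>This is \<open>v \<bullet> \<alpha> i\<close> minus
      \<open>\<mu> \<bullet> w (\<alpha> i)\<close>. As \<open>w (\<alpha> i)\<close> is a negative
      root, dominance of both points gives the sign.\<close>
    have "d \<bullet> \<alpha> i \<ge> 0" if "i \<in> J" for i
    proof -
      have i: "i \<in> {1..r}" and "\<not> nonneg (w (\<alpha> i))"
        using that by (auto simp: J_def)
      moreover have root: "w (\<alpha> i) \<in> \<Phi>"
        by (rule weyl_group_root[OF root_system w simple_root[OF i]])
      ultimately have "nonneg (- w (\<alpha> i))"
        using root_nonneg_or by blast
      then have "\<mu> \<bullet> (- w (\<alpha> i)) \<ge> 0"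
        using dominant_inner_nonneg[OF assms(2) span_neg[OF span_base[OF root]]] by blast
      moreover have "v \<bullet> \<alpha> i \<ge> 0"
        using assms(1) i by (auto simp: dominant_def)
      ultimately show ?thesis
        using weyl_group_inner_inv[OF w, of \<mu> "\<alpha> i"] by (simp add: d_def inner_diff_left)
    qed
    then have "(\<Sum>i\<in>J. (- coord i d) * (d \<bullet> \<alpha> i)) \<ge> 0"
      using neg by (intro sum_nonneg mult_nonneg_nonneg) (auto intro: less_imp_le)
    then show ?thesis
      by (simp add: x_def inner_sum_right)
  qed
  ultimately have "x \<bullet> x = 0"
    using inner_ge_zero[of x] by linarith
  then have "x = 0"
    by simp
  fix i assume i: "i \<in> {1..r}"
  show "nonneg (w (\<alpha> i))"
  proof (rule ccontr)
    assume "\<not> ?thesis"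
    \<comment> \<open>An index in \<open>J\<close> would give \<open>x\<close> a strictly positive
      coordinate.\<close>
    with i have iJ: "i \<in> J" by (simp add: J_def)
    have "coord i x = (\<Sum>k\<in>J. if k = i then - coord i d else 0)"
      unfolding x_def coord_sum
      by (intro sum.cong HOL.refl) (auto simp: coord_minus coord_scaleR coord_simple_root J_def)
    also have "\<dots> = - coord i d"
      using iJ by (simp add: J_def)
    finally show False
      using neg[OF iJ] \<open>x = 0\<close> by (simp add: coord_zero)
  qed
qed

text \<open>Both sides are Weyl invariant in \<open>\<mu>\<close>, so comparing them at dominant
  points is enough.\<close>

lemma cone_sum_eq:
  assumes "dominant r \<alpha> v" "v - \<mu> \<in> span \<Phi>"
  shows "cone_sum v \<mu> = of_bool (\<mu> \<in> weight_polytope \<Phi> v)"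
proof -
  have dom: "cone_sum v \<nu> = of_bool (\<nu> \<in> weight_polytope \<Phi> v)"
    if \<nu>: "dominant r \<alpha> \<nu>" "v - \<nu> \<in> span \<Phi>" for \<nu>
  proof -
    have "cone_sum v \<nu> = (\<Sum>w\<in>{id}. cone_term v w \<nu>)"
      unfolding cone_sum_def
      using cone_term_dominant[OF assms(1) \<nu>] finite_weyl_group[OF root_system]
      by (intro sum.mono_neutral_right) (auto intro: weyl_group.id)
    also have "\<dots> = (\<Prod>i=1..r. of_bool (coord i (v - \<nu>) \<ge> 0))"
      by (simp add: cone_term_def ray_def nonneg_simple_root)
    also have "\<dots> = of_bool (nonneg (v - \<nu>))"
      by (auto simp: nonneg_def prod_zero_iff)
    finally show ?thesis
      using dominant_mem_weight_polytope_iff[OF assms(1) \<nu>] by simp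
  qed
  obtain w where w: "w \<in> weyl_group \<Phi>" "dominant r \<alpha> (w \<mu>)"
    using dominant_representative by blast
  have "v - w \<mu> = (v - \<mu>) - (w \<mu> - \<mu>)" by simp
  also have "\<dots> \<in> span \<Phi>"
    by (intro span_diff assms weyl_group_diff_span w)
  finally have "cone_sum v (w \<mu>) = of_bool (w \<mu> \<in> weight_polytope \<Phi> v)"
    by (intro dom w)
  moreover have "w \<mu> \<in> weight_polytope \<Phi> v \<longleftrightarrow> \<mu> \<in> weight_polytope \<Phi> v"
    using weight_polytope_weyl_image w(1) weyl_group_inv
    by (metis weyl_group_inv_apply(2))
  ultimately show ?thesis
    by (simp add: cone_sum_weyl[OF w(1)])
qed

end

section \<open>The group algebra acting on all functions\<close>

lift_definition coefficient :: "('a, 'k::zero) group_algebra \<Rightarrow> 'a \<Rightarrow> 'k" is Poly_Mapping.lookup .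

lemma coefficient_inject: "(\<And>x. coefficient f x = coefficient g x) \<Longrightarrow> f = g"
  by transfer (rule poly_mapping_eqI)

lemma finite_coefficient_support: "finite {x. coefficient f x \<noteq> 0}"
  by transfer simp

lemma coefficient_add: "coefficient (f + g) x = coefficient f x + coefficient g x"
  and coefficient_diff: "coefficient (f - g) x = coefficient f x - coefficient g x"
  and coefficient_zero: "coefficient 0 x = 0"
  and coefficient_exponent: "coefficient (exponent \<mu>) x = of_bool (x = \<mu>)"
  for f g :: "('a::comm_monoid_add, 'k::comm_ring_1) group_algebra"
  by (transfer; simp add: lookup_add lookup_minus lookup_single when_def)+

lemma coefficient_sum: "coefficient (\<Sum>i\<in>I. f i) x = (\<Sum>i\<in>I. coefficient (f i) x)"
  for f :: "'i \<Rightarrow> ('a::comm_monoid_add, 'k::comm_ring_1) group_algebra"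
  by (induction I rule: infinite_finite_induct) (simp_all add: coefficient_zero coefficient_add)

lemma exponent_zero: "exponent 0 = 1"
  by transfer simp

lemma coefficient_mult:
  fixes f g :: "('a::ab_group_add, 'k::comm_ring_1) group_algebra"
  shows "coefficient (f * g) x = (\<Sum>y | coefficient f y \<noteq> 0. coefficient f y * coefficient g (x - y))"
proof (transfer fixing: x)
  fix f g :: "'a \<Rightarrow>\<^sub>0 'k"
  have *: "(\<Sum>q. Poly_Mapping.lookup g q when x = y + q) = Poly_Mapping.lookup g (x - y)" for y
  proof -
    have "x = y + q \<longleftrightarrow> q = x - y" for q by (auto simp: algebra_simps)
    then show ?thesis by simp
  qed
  have "Poly_Mapping.lookup (f * g) x = (\<Sum>y. Poly_Mapping.lookup f y * Poly_Mapping.lookup g (x - y))"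
    by (simp add: lookup_mult *)
  also have "\<dots> = (\<Sum>y | Poly_Mapping.lookup f y \<noteq> 0. Poly_Mapping.lookup f y * Poly_Mapping.lookup g (x - y))"
    by (rule Sum_any.expand_superset) auto
  finally show "Poly_Mapping.lookup (f * g) x = \<dots>" .
qed

text \<open>Convolution with an arbitrary function, meaningful because \<open>f\<close> has finite
  support. Functions thus form a module over the group algebra that contains the cone
  indicators.\<close>

definition act :: "('a::ab_group_add, 'k::comm_ring_1) group_algebra \<Rightarrow> ('a \<Rightarrow> 'k) \<Rightarrow> 'a \<Rightarrow> 'k" where
  "act f g x = (\<Sum>y | coefficient f y \<noteq> 0. coefficient f y * g (x - y))"

lemma act_coefficient: "act f (coefficient g) = coefficient (f * g)"
  by (simp add: act_def coefficient_mult fun_eq_iff)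

lemma act_superset:
  assumes "finite Y" "{y. coefficient f y \<noteq> 0} \<subseteq> Y"
  shows "act f g x = (\<Sum>y\<in>Y. coefficient f y * g (x - y))"
  unfolding act_def using assms by (intro sum.mono_neutral_left) auto

lemma act_sum: "act f (\<lambda>x. \<Sum>i\<in>I. g i x) x = (\<Sum>i\<in>I. act f (g i) x)"
  unfolding act_def sum_distrib_left by (rule sum.swap)

lemma act_diff: "act (f - h) g x = act f g x - act h g x"
proof -
  let ?Y = "{y. coefficient f y \<noteq> 0} \<union> {y. coefficient h y \<noteq> 0}"
  have "finite ?Y" by (simp add: finite_coefficient_support)
  moreover have "{y. coefficient (f - h) y \<noteq> 0} \<subseteq> ?Y" by (auto simp: coefficient_diff)
  ultimately show ?thesis
    by (simp add: act_superset[of ?Y] coefficient_diff left_diff_distrib sum_subtractf)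
qed

lemma act_exponent: "act (exponent \<mu>) g x = g (x - \<mu>)"
  by (subst act_superset[of "{\<mu>}"]) (auto simp: coefficient_exponent)

lemma act_one: "act 1 g = g"
  using act_exponent[of 0 g] by (simp add: exponent_zero fun_eq_iff)

text \<open>The module law, by exchanging finite sums. It allows the factors of a denominator to be
  applied one after another.\<close>

lemma act_mult:
  fixes f h :: "('a::ab_group_add, 'k::comm_ring_1) group_algebra"
  shows "act (f * h) g = act f (act h g)"
proof
  fix x
  define F where "F = {y. coefficient f y \<noteq> 0}"
  define H where "H = {y. coefficient h y \<noteq> 0}"
  \<comment> \<open>The sumset contains the support of \<open>f * h\<close>, which cancellation may
    make strictly smaller.\<close>
  define Y where "Y = (\<lambda>(y, z). y + z) ` (F \<times> H)"
  have fin: "finite F" "finite H" "finite Y"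
    by (simp_all add: F_def H_def Y_def finite_coefficient_support)
  have mem_Y: "u \<in> Y" if "y \<in> F" "coefficient h (u - y) \<noteq> 0" for u y
    unfolding Y_def using that by (intro image_eqI[of _ _ "(y, u - y)"]) (auto simp: H_def)
  have "{u. coefficient (f * h) u \<noteq> 0} \<subseteq> Y"
  proof (rule subsetI, rule ccontr)
    fix u assume "u \<in> {u. coefficient (f * h) u \<noteq> 0}" "u \<notin> Y"
    then have "coefficient (f * h) u \<noteq> 0" "\<And>y. y \<in> F \<Longrightarrow> coefficient h (u - y) = 0"
      using mem_Y by auto
    then show False by (simp add: coefficient_mult F_def)
  qed
  then have "act (f * h) g x = (\<Sum>u\<in>Y. coefficient (f * h) u * g (x - u))"
    by (rule act_superset[OF fin(3)])
  also have "\<dots> = (\<Sum>u\<in>Y. \<Sum>y\<in>F. coefficient f y * (coefficient h (u - y) * g (x - u)))"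
    by (simp add: coefficient_mult F_def sum_distrib_right mult.assoc)
  also have "\<dots> = (\<Sum>y\<in>F. coefficient f y * (\<Sum>u\<in>Y. coefficient h (u - y) * g (x - u)))"
    by (subst sum.swap) (simp add: sum_distrib_left)
  also have "\<dots> = (\<Sum>y\<in>F. coefficient f y * act h g (x - y))"
  proof (intro sum.cong HOL.refl arg_cong[where f = "(*) _"])
    fix y assume y: "y \<in> F"
    have "(\<Sum>u\<in>Y. coefficient h (u - y) * g (x - u)) = (\<Sum>u\<in>(+) y ` H. coefficient h (u - y) * g (x - u))"
    proof (rule sum.mono_neutral_right[OF fin(3)])
      show "(+) y ` H \<subseteq> Y"
        using y unfolding Y_def by force
      have "coefficient h (u - y) = 0" if "u \<notin> (+) y ` H" for u
      proof (rule ccontr)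
        assume "coefficient h (u - y) \<noteq> 0"
        then have "y + (u - y) \<in> (+) y ` H"
          by (intro imageI) (simp add: H_def)
        with that show False by simp
      qed
      then show "\<forall>u\<in>Y - (+) y ` H. coefficient h (u - y) * g (x - u) = 0"
        by simp
    qed
    also have "\<dots> = act h g (x - y)"
      by (subst sum.reindex) (auto simp: act_def H_def algebra_simps)
    finally show "(\<Sum>u\<in>Y. coefficient h (u - y) * g (x - u)) = act h g (x - y)" .
  qed
  also have "\<dots> = act f (act h g) x"
    by (simp add: act_def F_def)
  finally show "act (f * h) g x = act f (act h g) x" .
qed

section \<open>The root and weight lattices\<close>

context simple_system
begin

text \<open>The simple roots are an integral basis of the root lattice, because all roots have
  integer coordinates in them.\<close>

lemma root_lattice_iff:
  "x \<in> root_lattice \<Phi> \<longleftrightarrow> x \<in> span \<Phi> \<and> (\<forall>i\<in>{1..r}. coord i x \<in> \<int>)"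
proof
  assume "x \<in> root_lattice \<Phi>"
  then obtain c :: "'a \<Rightarrow> int" where x: "x = (\<Sum>\<beta>\<in>\<Phi>. of_int (c \<beta>) *\<^sub>R \<beta>)"
    by (auto simp: root_lattice_def)
  show "x \<in> span \<Phi> \<and> (\<forall>i\<in>{1..r}. coord i x \<in> \<int>)"
    unfolding x
  proof (intro conjI ballI)
    show "(\<Sum>\<beta>\<in>\<Phi>. of_int (c \<beta>) *\<^sub>R \<beta>) \<in> span \<Phi>"
      by (intro span_sum span_scale span_base)
    show "coord i (\<Sum>\<beta>\<in>\<Phi>. of_int (c \<beta>) *\<^sub>R \<beta>) \<in> \<int>" if "i \<in> {1..r}" for i
      unfolding coord_sum coord_scaleR real_scaleR_def
      by (intro Ints_sum Ints_mult Ints_of_int coord_root_Ints that)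
  qed
next
  assume x: "x \<in> span \<Phi> \<and> (\<forall>i\<in>{1..r}. coord i x \<in> \<int>)"
  \<comment> \<open>The coefficients live on the simple roots only; the floor is exact here and
    merely passes to type \<open>int\<close>.\<close>
  define c where "c \<beta> = (if \<beta> \<in> \<alpha> ` {1..r} then \<lfloor>coord (inv_into {1..r} \<alpha> \<beta>) x\<rfloor> else 0)" for \<beta>
  have inj: "inj_on \<alpha> {1..r}"
    using simple_roots by (auto simp: simple_roots_def)
  have "x = (\<Sum>i=1..r. coord i x *\<^sub>R \<alpha> i)"
    using x coord_representation by blast
  also have "\<dots> = (\<Sum>i=1..r. of_int (c (\<alpha> i)) *\<^sub>R \<alpha> i)"
    using x inj by (intro sum.cong HOL.refl) (auto simp: c_def inv_into_f_f simp del: atLeastAtMost_iff)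
  also have "\<dots> = (\<Sum>\<beta>\<in>\<alpha> ` {1..r}. of_int (c \<beta>) *\<^sub>R \<beta>)"
    by (simp add: sum.reindex[OF inj])
  also have "\<dots> = (\<Sum>\<beta>\<in>\<Phi>. of_int (c \<beta>) *\<^sub>R \<beta>)"
    using root_system simple_root
    by (intro sum.mono_neutral_left) (auto simp: c_def root_system_def simp del: atLeastAtMost_iff)
  finally show "x \<in> root_lattice \<Phi>"
    unfolding root_lattice_def by blast
qed

lemma root_lattice_zero: "0 \<in> root_lattice \<Phi>"
  by (simp add: root_lattice_iff coord_zero span_zero)

lemma root_lattice_add: "x \<in> root_lattice \<Phi> \<Longrightarrow> y \<in> root_lattice \<Phi> \<Longrightarrow> x + y \<in> root_lattice \<Phi>"
  by (simp add: root_lattice_iff coord_add span_add del: atLeastAtMost_iff)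

lemma root_lattice_minus: "x \<in> root_lattice \<Phi> \<Longrightarrow> - x \<in> root_lattice \<Phi>"
  by (simp add: root_lattice_iff coord_minus span_neg del: atLeastAtMost_iff)

lemma root_lattice_diff: "x \<in> root_lattice \<Phi> \<Longrightarrow> y \<in> root_lattice \<Phi> \<Longrightarrow> x - y \<in> root_lattice \<Phi>"
  using root_lattice_add[OF _ root_lattice_minus, of x y] by simp

lemma root_lattice_scale_int:
  "x \<in> root_lattice \<Phi> \<Longrightarrow> c \<in> \<int> \<Longrightarrow> c *\<^sub>R x \<in> root_lattice \<Phi>"
  by (simp add: root_lattice_iff coord_scaleR span_scale del: atLeastAtMost_iff)

lemma root_in_root_lattice: "\<beta> \<in> \<Phi> \<Longrightarrow> \<beta> \<in> root_lattice \<Phi>"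
  by (simp add: root_lattice_iff span_base coord_root_Ints del: atLeastAtMost_iff)

lemma root_lattice_weyl:
  assumes "w \<in> weyl_group \<Phi>" "x \<in> root_lattice \<Phi>"
  shows "w x \<in> root_lattice \<Phi>"
proof -
  obtain c :: "'a \<Rightarrow> int" where x: "x = (\<Sum>\<beta>\<in>\<Phi>. of_int (c \<beta>) *\<^sub>R \<beta>)"
    using assms(2) by (auto simp: root_lattice_def)
  have "w x = (\<Sum>\<beta>\<in>\<Phi>. of_int (c \<beta>) *\<^sub>R w \<beta>)"
    unfolding x
    by (simp add: linear_sum[OF weyl_group_linear[OF assms(1)]] linear_scale[OF weyl_group_linear[OF assms(1)]])
  moreover have "(\<Sum>\<beta>\<in>S. of_int (c \<beta>) *\<^sub>R w \<beta>) \<in> root_lattice \<Phi>" if "finite S" "S \<subseteq> \<Phi>" for S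
    using that
  proof (induction S rule: finite_induct)
    case empty
    then show ?case by (simp add: root_lattice_zero)
  next
    case (insert \<beta> S)
    then have "w \<beta> \<in> root_lattice \<Phi>"
      using root_in_root_lattice weyl_group_root[OF root_system assms(1)] by blast
    with insert show ?case
      by (simp add: root_lattice_add root_lattice_scale_int)
  qed
  ultimately show ?thesis
    using root_system by (auto simp: root_system_def)
qed

text \<open>Each further reflection subtracts a multiple of its root. The multiplier is an integer,
  since moving \<open>w\<close> across the inner product pairs the weight \<open>v\<close> with
  another root.\<close>

lemma weight_diff_root_lattice:
  assumes "w \<in> weyl_group \<Phi>" "v \<in> weight_lattice \<Phi>"
  shows "w v - v \<in> root_lattice \<Phi>"
  using assms(1)
proof (induction rule: weyl_group.induct)
  case id
  then show ?case by (simp add: root_lattice_zero)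
next
  case (refl \<beta> w)
  have inv: "inv w \<beta> \<in> \<Phi>"
    by (rule weyl_group_root[OF root_system weyl_group_inv[OF refl.hyps(2)] refl.hyps(1)])
  have "w v \<bullet> \<beta> = v \<bullet> inv w \<beta>"
    using weyl_group_inner_inv[OF refl.hyps(2), of \<beta> v] by (metis inner_commute)
  moreover have "\<beta> \<bullet> \<beta> = inv w \<beta> \<bullet> inv w \<beta>"
    using weyl_group_inner[OF weyl_group_inv[OF refl.hyps(2)], of \<beta> \<beta>] by metis
  ultimately have "2 * (w v \<bullet> \<beta>) / (\<beta> \<bullet> \<beta>) \<in> \<int>"
    using assms(2) inv by (auto simp: weight_lattice_def)
  then have "(w v - v) - (2 * (w v \<bullet> \<beta>) / (\<beta> \<bullet> \<beta>)) *\<^sub>R \<beta> \<in> root_lattice \<Phi>"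
    using root_lattice_diff[OF refl.IH root_lattice_scale_int[OF root_in_root_lattice[OF refl.hyps(1)]]]
    by blast
  then show ?case
    by (simp add: refl_along_def algebra_simps)
qed

text \<open>The coordinates of \<open>\<mu> - v\<close> are integers, and they are bounded because
  the polytope is.\<close>

lemma finite_lattice_points:
  "finite (weight_polytope \<Phi> v \<inter> (\<lambda>\<beta>. \<beta> + v) ` root_lattice \<Phi>)"
proof -
  let ?P = "weight_polytope \<Phi> v \<inter> (\<lambda>\<beta>. \<beta> + v) ` root_lattice \<Phi>"
  have "{w v |w. w \<in> weyl_group \<Phi>} = (\<lambda>w. w v) ` weyl_group \<Phi>"
    by blast
  then have bounded: "bounded (weight_polytope \<Phi> v)"
    using finite_weyl_group[OF root_system]
    by (simp add: weight_polytope_def finite_imp_bounded_convex_hull)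
  have "\<exists>b. \<forall>\<mu>\<in>weight_polytope \<Phi> v. \<bar>coord i (\<mu> - v)\<bar> \<le> b" for i
  proof -
    have "bounded (coord i ` (\<lambda>\<mu>. \<mu> - v) ` weight_polytope \<Phi> v)"
    proof (rule bounded_linear_image)
      show "bounded ((\<lambda>\<mu>. \<mu> - v) ` weight_polytope \<Phi> v)"
        using bounded_translation[OF bounded, of "- v"] by simp
      show "bounded_linear (coord i)"
        using linear_coord by (simp add: linear_conv_bounded_linear)
    qed
    then show ?thesis
      by (auto simp: bounded_iff)
  qed
  then obtain b where b: "\<And>i \<mu>. \<mu> \<in> weight_polytope \<Phi> v \<Longrightarrow> \<bar>coord i (\<mu> - v)\<bar> \<le> b i"
    by metis
  let ?B = "\<lambda>i. {c \<in> \<int>. \<bar>c\<bar> \<le> b i}"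
  show ?thesis
  proof (rule finite_subset)
    show "?P \<subseteq> (\<lambda>c. (\<Sum>i=1..r. c i *\<^sub>R \<alpha> i) + v) ` (\<Pi>\<^sub>E i\<in>{1..r}. ?B i)"
    proof
      fix \<mu> assume \<mu>: "\<mu> \<in> ?P"
      then have L: "\<mu> - v \<in> root_lattice \<Phi>" by auto
      have "\<mu> = (\<Sum>i=1..r. coord i (\<mu> - v) *\<^sub>R \<alpha> i) + v"
        using coord_representation[of "\<mu> - v"] L by (simp add: root_lattice_iff)
      also have "(\<Sum>i=1..r. coord i (\<mu> - v) *\<^sub>R \<alpha> i) =
          (\<Sum>i=1..r. restrict (\<lambda>i. coord i (\<mu> - v)) {1..r} i *\<^sub>R \<alpha> i)"
        by (intro sum.cong) auto
      finally show "\<mu> \<in> (\<lambda>c. (\<Sum>i=1..r. c i *\<^sub>R \<alpha> i) + v) ` (\<Pi>\<^sub>E i\<in>{1..r}. ?B i)"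
        using L \<mu> b by (intro image_eqI[of _ _ "restrict (\<lambda>i. coord i (\<mu> - v)) {1..r}"])
          (auto simp: root_lattice_iff simp del: atLeastAtMost_iff)
    qed
    show "finite ((\<lambda>c. (\<Sum>i=1..r. c i *\<^sub>R \<alpha> i) + v) ` (\<Pi>\<^sub>E i\<in>{1..r}. ?B i))"
      by (intro finite_imageI finite_PiE finite_abs_int_segment) auto
  qed
qed

section \<open>Brion's formula\<close>

definition cone_fun :: "'a \<Rightarrow> ('a \<Rightarrow> 'a) \<Rightarrow> 'a \<Rightarrow> 'k::comm_ring_1" where
  "cone_fun v w \<mu> = of_bool (\<mu> - v \<in> root_lattice \<Phi>) * of_int (cone_term v w \<mu>)"

definition cone_denom :: "('a \<Rightarrow> 'a) \<Rightarrow> ('a, 'k::idom) group_algebra" where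
  "cone_denom w = (\<Prod>i=1..r. 1 - exponent (- w (\<alpha> i)))"

text \<open>\<open>w (v - inv w \<mu>)\<close> is \<open>w v - \<mu>\<close>, and \<open>w v\<close>
  is congruent to \<open>v\<close> modulo the root lattice because \<open>v\<close> is a
  weight.\<close>

lemma root_lattice_shift:
  assumes "w \<in> weyl_group \<Phi>" "v \<in> weight_lattice \<Phi>"
  shows "v - inv w \<mu> \<in> root_lattice \<Phi> \<longleftrightarrow> \<mu> - v \<in> root_lattice \<Phi>"
proof
  assume "v - inv w \<mu> \<in> root_lattice \<Phi>"
  then have "w (v - inv w \<mu>) \<in> root_lattice \<Phi>"
    by (rule root_lattice_weyl[OF assms(1)])
  then have "(w v - v) - w (v - inv w \<mu>) \<in> root_lattice \<Phi>"
    by (intro root_lattice_diff weight_diff_root_lattice assms)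
  then show "\<mu> - v \<in> root_lattice \<Phi>"
    using assms(1) by (simp add: linear_diff[OF weyl_group_linear])
next
  assume "\<mu> - v \<in> root_lattice \<Phi>"
  then have "inv w (\<mu> - v) \<in> root_lattice \<Phi>"
    by (rule root_lattice_weyl[OF weyl_group_inv[OF assms(1)]])
  then have "- (inv w (\<mu> - v) + (inv w v - v)) \<in> root_lattice \<Phi>"
    by (intro root_lattice_minus root_lattice_add weight_diff_root_lattice weyl_group_inv assms)
  then show "v - inv w \<mu> \<in> root_lattice \<Phi>"
    using linear_diff[OF weyl_group_linear[OF weyl_group_inv[OF assms(1)]]] by simp
qed

text \<open>Either expansion telescopes to a point mass at 0. The difference is also 1 strictly
  between 0 and 1, hence the restriction to integers.\<close>

lemma ray_step:
  assumes "c \<in> \<int>"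
  shows "ray p c - ray p (c - 1) = of_bool (c = 0)"
proof -
  obtain n where "c = of_int n" using assms by (auto elim: Ints_cases)
  then show ?thesis by (auto simp: ray_def)
qed

text \<open>The factors of the denominator act one at a time, each collapsing one ray to a point
  mass.\<close>

lemma act_cone_denom:
  assumes w: "w \<in> weyl_group \<Phi>" and v: "v \<in> weight_lattice \<Phi>"
  shows "act (cone_denom w) (cone_fun v w) = coefficient (exponent (w v) :: ('a, 'k::idom) group_algebra)"
proof -
  \<comment> \<open>\<open>g I\<close> is the state after the factors in \<open>I\<close> have
    acted, as a function of \<open>x = v - inv w \<mu>\<close>: coordinates in \<open>I\<close> are
    point masses already, the others are still rays.\<close>
  define g :: "nat set \<Rightarrow> 'a \<Rightarrow> 'k" where
    "g I x = of_bool (x \<in> root_lattice \<Phi>) *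
      (\<Prod>i=1..r. if i \<in> I then of_bool (coord i x = 0) else of_int (ray (nonneg (w (\<alpha> i))) (coord i x)))"
    for I x
  have step: "g I x - g I (x - \<alpha> j) = g (insert j I) x" if j: "j \<in> {1..r}" "j \<notin> I" for I j x
  proof (cases "x \<in> root_lattice \<Phi>")
    case False
    have "x - \<alpha> j \<notin> root_lattice \<Phi>"
      using False root_lattice_add[of "x - \<alpha> j" "\<alpha> j"] root_in_root_lattice[OF simple_root[OF j(1)]] by auto
    with False show ?thesis by (simp add: g_def)
  next
    case True
    then have L: "x - \<alpha> j \<in> root_lattice \<Phi>"
      using root_lattice_diff root_in_root_lattice[OF simple_root[OF j(1)]] by blast
    define h :: "nat \<Rightarrow> 'k" where
      "h i = (if i \<in> I then of_bool (coord i x = 0) else of_int (ray (nonneg (w (\<alpha> i))) (coord i x)))" for i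
    define A where "A = (\<Prod>i\<in>{1..r} - {j}. h i)"
    let ?ray = "\<lambda>c. of_int (ray (nonneg (w (\<alpha> j))) c) :: 'k"
    have "g I x = ?ray (coord j x) * A"
      using j True by (simp add: g_def prod.remove[of _ j] A_def h_def del: atLeastAtMost_iff)
    moreover have "g I (x - \<alpha> j) = ?ray (coord j x - 1) * A"
    proof -
      have "A = (\<Prod>i\<in>{1..r} - {j}. if i \<in> I then of_bool (coord i (x - \<alpha> j) = 0)
          else of_int (ray (nonneg (w (\<alpha> i))) (coord i (x - \<alpha> j))))"
        unfolding A_def h_def using j(1)
        by (intro prod.cong HOL.refl) (auto simp: coord_diff coord_simple_root simp del: atLeastAtMost_iff)
      then show ?thesis
        using j L unfolding g_def
        by (simp add: prod.remove[of _ j] coord_diff[of j] coord_simple_root del: atLeastAtMost_iff)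
    qed
    moreover have "g (insert j I) x = of_bool (coord j x = 0) * A"
      using j True unfolding g_def A_def h_def
      by (simp add: prod.remove[of _ j] del: atLeastAtMost_iff)
    moreover have "?ray (coord j x) - ?ray (coord j x - 1) = of_bool (coord j x = 0)"
    proof -
      have "coord j x \<in> \<int>"
        using True j(1) by (auto simp: root_lattice_iff)
      then show ?thesis
        using ray_step[of "coord j x" "nonneg (w (\<alpha> j))"] by (metis of_int_diff of_int_of_bool)
    qed
    ultimately show ?thesis
      by (simp flip: left_diff_distrib)
  qed
  have "act (\<Prod>i\<in>I. 1 - exponent (- w (\<alpha> i))) (cone_fun v w) = (\<lambda>\<mu>. g I (v - inv w \<mu>))"
    if "finite I" "I \<subseteq> {1..r}" for I
    using that
  proof (induction I rule: finite_induct)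
    case empty
    then show ?case
      by (simp add: act_one fun_eq_iff cone_fun_def g_def cone_term_def root_lattice_shift[OF w v] of_int_prod)
  next
    case (insert j I)
    have "act (\<Prod>i\<in>insert j I. 1 - exponent (- w (\<alpha> i))) (cone_fun v w) =
        act (1 - exponent (- w (\<alpha> j))) (\<lambda>\<mu>. g I (v - inv w \<mu>))"
      using insert by (simp add: act_mult)
    \<comment> \<open>Acting by \<open>exponent (- w (\<alpha> j))\<close> evaluates at
      \<open>\<mu> + w (\<alpha> j)\<close>, which subtracts \<open>\<alpha> j\<close> from
      \<open>x\<close>.\<close>
    also have "\<dots> = (\<lambda>\<mu>. g I (v - inv w \<mu>) - g I (v - inv w (\<mu> + w (\<alpha> j))))"
      by (simp add: fun_eq_iff act_diff act_one act_exponent)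
    also have "\<dots> = (\<lambda>\<mu>. g I (v - inv w \<mu>) - g I (v - inv w \<mu> - \<alpha> j))"
      using w linear_add[OF weyl_group_linear[OF weyl_group_inv[OF w]]] by (simp add: algebra_simps)
    also have "\<dots> = (\<lambda>\<mu>. g (insert j I) (v - inv w \<mu>))"
      using insert by (simp add: step del: atLeastAtMost_iff)
    finally show ?case .
  qed
  from this[of "{1..r}"]
  have "act (cone_denom w) (cone_fun v w) = (\<lambda>\<mu>. g {1..r} (v - inv w \<mu>))"
    by (simp add: cone_denom_def)
  also have "\<dots> = (\<lambda>\<mu>. of_bool (\<mu> = w v))"
  proof
    fix \<mu>
    have zero: "x = 0 \<longleftrightarrow> x \<in> root_lattice \<Phi> \<and> (\<forall>i\<in>{1..r}. coord i x = 0)" for x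
      using coord_eqI[of x 0] by (auto simp: root_lattice_iff span_zero coord_zero simp del: atLeastAtMost_iff)
    have "g {1..r} x = of_bool (x = 0)" for x
      by (subst zero) (auto simp: g_def prod_zero_iff simp del: atLeastAtMost_iff)
    moreover have "v - inv w \<mu> = 0 \<longleftrightarrow> \<mu> = w v"
      using w by (metis eq_iff_diff_eq_0 weyl_group_inv_apply)
    ultimately show "g {1..r} (v - inv w \<mu>) = of_bool (\<mu> = w v)"
      by simp
  qed
  finally show ?thesis
    by (simp add: coefficient_exponent fun_eq_iff)
qed

text \<open>The coefficient at 0 shows that no factor vanishes, and the group algebra is an integral
  domain.\<close>

lemma cone_denom_nonzero:
  assumes "w \<in> weyl_group \<Phi>"
  shows "(cone_denom w :: ('a, 'k::idom) group_algebra) \<noteq> 0"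
proof -
  have "1 - exponent (- w (\<alpha> i)) \<noteq> (0 :: ('a, 'k) group_algebra)" if "i \<in> {1..r}" for i
  proof
    assume "1 - exponent (- w (\<alpha> i)) = (0 :: ('a, 'k) group_algebra)"
    then have "coefficient (exponent 0 :: ('a, 'k) group_algebra) 0 = coefficient (exponent (- w (\<alpha> i)) :: ('a, 'k) group_algebra) 0"
      by (simp add: exponent_zero)
    then have "w (\<alpha> i) = 0"
      by (simp add: coefficient_exponent)
    then show False
      using root_nonzero[OF weyl_group_root[OF root_system assms simple_root[OF that]]] by simp
  qed
  then show ?thesis
    by (simp add: cone_denom_def del: atLeastAtMost_iff)
qed

theorem lattice_point_sum_eq:
  assumes "v \<in> weight_lattice \<Phi>" "dominant r \<alpha> v"
  shows "(lattice_point_sum \<Phi> v :: ('a, 'k::idom) group_algebra fract) =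
    (\<Sum>w\<in>weyl_group \<Phi>. fexp (w v) / (\<Prod>i=1..r. 1 - fexp (- w (\<alpha> i))))"
proof -
  let ?W = "weyl_group \<Phi>"
  let ?P = "weight_polytope \<Phi> v \<inter> (\<lambda>\<beta>. \<beta> + v) ` root_lattice \<Phi>"
  let ?d = "cone_denom :: _ \<Rightarrow> ('a, 'k) group_algebra"
  note finW = finite_weyl_group[OF root_system]
  define S :: "('a, 'k) group_algebra" where "S = (\<Sum>\<mu>\<in>?P. exponent \<mu>)"
  \<comment> \<open>\<open>D\<close> is the common denominator and \<open>E w\<close> the cofactor
    of \<open>w\<close>, so that the identity can be proved in the group algebra before any
    division.\<close>
  define D where "D = (\<Prod>w\<in>?W. ?d w)"
  define E where "E w = (\<Prod>u\<in>?W - {w}. ?d u)" for w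
  have D: "D = E w * ?d w" if "w \<in> ?W" for w
    using finW that by (simp add: D_def E_def prod.remove mult.commute)
  have coefficient_S: "coefficient S = (\<lambda>\<mu>. \<Sum>w\<in>?W. cone_fun v w \<mu>)"
  proof
    fix \<mu>
    have "coefficient S \<mu> = (\<Sum>\<nu>\<in>?P. if \<nu> = \<mu> then 1 else 0)"
      by (auto simp: S_def coefficient_sum coefficient_exponent intro!: sum.cong)
    \<comment> \<open>Finiteness matters: over an infinite index set the sum would default to
      0.\<close>
    also have "\<dots> = of_bool (\<mu> \<in> ?P)"
      using finite_lattice_points[of v] by simp
    also have "\<dots> = of_bool (\<mu> - v \<in> root_lattice \<Phi>) * of_int (cone_sum v \<mu>)"
    proof (cases "\<mu> - v \<in> root_lattice \<Phi>")
      case True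
      then have "v - \<mu> \<in> span \<Phi>"
        using span_neg[of "\<mu> - v" \<Phi>] by (simp add: root_lattice_iff)
      then show ?thesis
        using cone_sum_eq[OF assms(2)] True by (auto simp: image_iff intro!: bexI[of _ "\<mu> - v"])
    next
      case False
      then show ?thesis by auto
    qed
    finally show "coefficient S \<mu> = (\<Sum>w\<in>?W. cone_fun v w \<mu>)"
      by (simp add: cone_fun_def cone_sum_def of_int_sum sum_distrib_left)
  qed
  \<comment> \<open>On the cone function of \<open>w\<close>, \<open>D\<close> acts as
    \<open>cone_denom w\<close> followed by \<open>E w\<close>. The first step leaves a point mass,
    so the result is again an element of the group algebra.\<close>
  have "D * S = (\<Sum>w\<in>?W. E w * exponent (w v))"
  proof (rule coefficient_inject)
    fix x
    have "coefficient (D * S) x = (\<Sum>w\<in>?W. act D (cone_fun v w) x)"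
      by (simp add: coefficient_S act_sum flip: act_coefficient)
    also have "\<dots> = (\<Sum>w\<in>?W. coefficient (E w * exponent (w v)) x)"
      by (intro sum.cong HOL.refl) (simp add: D act_mult act_cone_denom assms act_coefficient)
    finally show "coefficient (D * S) x = coefficient (\<Sum>w\<in>?W. E w * exponent (w v)) x"
      by (simp add: coefficient_sum)
  qed
  then have eq: "to_fract D * to_fract S = (\<Sum>w\<in>?W. to_fract (E w) * fexp (w v))"
    by (simp add: fexp_def flip: to_fract_mult to_fract_sum)
  have nz: "D \<noteq> 0"
    using finW cone_denom_nonzero by (auto simp: D_def)
  have denom: "to_fract (?d w) = (\<Prod>i=1..r. 1 - fexp (- w (\<alpha> i)))" for w
  proof -
    have "to_fract (\<Prod>i\<in>I. 1 - exponent (- w (\<alpha> i)) :: ('a, 'k) group_algebra) =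
        (\<Prod>i\<in>I. 1 - fexp (- w (\<alpha> i)))" for I
      by (induction I rule: infinite_finite_induct) (simp_all add: fexp_def)
    then show ?thesis by (simp add: cone_denom_def)
  qed
  have "to_fract S = (\<Sum>w\<in>?W. to_fract (E w) * fexp (w v)) / to_fract D"
    using eq nz by (simp add: field_simps)
  also have "\<dots> = (\<Sum>w\<in>?W. fexp (w v) / to_fract (?d w))"
    unfolding sum_divide_distrib
  proof (intro sum.cong HOL.refl)
    fix w assume w: "w \<in> ?W"
    have "E w \<noteq> 0"
      using nz D[OF w] by auto
    then show "to_fract (E w) * fexp (w v) / to_fract D = fexp (w v) / to_fract (?d w)"
      by (simp add: D[OF w])
  qed
  finally show ?thesis
    by (simp add: denom lattice_point_sum_def S_def fexp_def)
qed

end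

theorem theorem4p3:
  fixes \<Phi> :: "'a::euclidean_space set"
    and r :: nat
    and \<alpha> :: "nat \<Rightarrow> 'a"
    and lam :: 'a
  assumes "root_system \<Phi>"
    and "dim \<Phi> = r"
    and "simple_roots \<Phi> r \<alpha>"
    and "lam \<in> weight_lattice \<Phi>"
    and "dominant r \<alpha> lam"
  shows "(lattice_point_sum \<Phi> lam :: ('a, 'k::idom) group_algebra fract) =
    (\<Sum>w \<in> weyl_group \<Phi>. fexp (w lam) / (\<Prod>i=1..r. 1 - fexp (- w (\<alpha> i))))"
proof -
  interpret simple_system \<Phi> r \<alpha>
    using assms by unfold_locales
  show ?thesis
    using assms by (intro lattice_point_sum_eq)
qed

end
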